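(* Let $S$ be a finitely-generated semidiscrete semigroup such that $|\Lambda^-(S)|\neq 1$. If $\Lambda^-(S)\subset\Lambda^+(S)$, then $S$ is a group.
   Context: $\mathbb{H}$ is the upper half-plane and $\overline{\mathbb{R}}=\mathbb{R}\cup\{\infty\}$ its ideal boundary in $\overline{\mathbb{C}}$ (with the chordal metric). $\mathcal{M}\cong\mathrm{PSL}(2,\mathbb{R})$ is the topological group of real Möbius transformations $z\mapsto (az+b)/(cz+d)$ ($a,b,c,d\in\mathbb{R}$, $ad-bc>0$), with identity $I$. A semigroup is a nonempty subset of $\mathcal{M}$ closed under composition; it is finitely generated if there is a finite subset of it such that every element is a finite composition of elements of that subset. $S$ is semidiscrete if $I$ is not an accumulation point of $S$ in $\mathcal{M}$. The forward limit set $\Lambda^+(S)$ is the set of accumulation points in $\overline{\mathbb{R}}$ (chordal metric) of the orbit $\{g(w):g\in S\}$, where $w\in\mathbb{H}$; it does not depend on $w$. The backward limit set is $\Lambda^-(S)=\Lambda^+(S^{-1})$, where $S^{-1}=\{g^{-1}:g\in S\}$. The symbol $\subset$ allows equality. *)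

theory Defs
  imports "HOL-Analysis.Analysis" "HOL-Algebra.Group"
begin

section \<open>The Riemann sphere with the chordal metric\<close>

datatype csphere = Fin complex | Infty

fun chordal :: "csphere \<Rightarrow> csphere \<Rightarrow> real" where
  "chordal (Fin z) (Fin w) =
     2 * cmod (z - w) / (sqrt (1 + (cmod z)\<^sup>2) * sqrt (1 + (cmod w)\<^sup>2))"
| "chordal (Fin z) Infty = 2 / sqrt (1 + (cmod z)\<^sup>2)"
| "chordal Infty (Fin w) = 2 / sqrt (1 + (cmod w)\<^sup>2)"
| "chordal Infty Infty = 0"

text \<open>Inverse stereographic projection onto the unit sphere, used only to obtain the metric
  axioms: the chordal metric is the Euclidean distance of the projected points.\<close>

fun stereo :: "csphere \<Rightarrow> real \<times> real \<times> real" where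
  "stereo (Fin z) = (2 * Re z / (1 + (cmod z)\<^sup>2), 2 * Im z / (1 + (cmod z)\<^sup>2),
                      1 - 2 / (1 + (cmod z)\<^sup>2))"
| "stereo Infty = (0, 0, 1)"

lemma one_plus_cmod_pos: "0 < 1 + (cmod z)\<^sup>2"
  by (simp add: add_pos_nonneg)

lemma chordal_eq_dist_stereo: "chordal p q = dist (stereo p) (stereo q)"
proof -
  have FI: "2 / sqrt (1 + (cmod z)\<^sup>2) = dist (stereo (Fin z)) (stereo Infty)" for z
  proof -
    define u where "u = 1 / (1 + (cmod z)\<^sup>2)"
    have u: "(1 + (Re z)\<^sup>2 + (Im z)\<^sup>2) * u = 1"
      using one_plus_cmod_pos[of z] by (simp add: u_def cmod_power2)
    have "u > 0" unfolding u_def using one_plus_cmod_pos by simp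
    have "(2 * Re z * u)\<^sup>2 + ((2 * Im z * u)\<^sup>2 + (2 * u)\<^sup>2)
            = 4 * u * ((1 + (Re z)\<^sup>2 + (Im z)\<^sup>2) * u)"
      by (simp add: power2_eq_square algebra_simps)
    also have "\<dots> = 4 * u" using u by simp
    finally have "dist (stereo (Fin z)) (stereo Infty) = sqrt (4 * u)"
      by (simp add: dist_prod_def dist_real_def u_def power2_eq_square)
    then show ?thesis
      by (simp add: u_def real_sqrt_mult real_sqrt_divide)
  qed
  have FF: "2 * cmod (z - w) / (sqrt (1 + (cmod z)\<^sup>2) * sqrt (1 + (cmod w)\<^sup>2))
              = dist (stereo (Fin z)) (stereo (Fin w))" for z w
  proof -
    define u where "u = 1 / (1 + (cmod z)\<^sup>2)"
    define v where "v = 1 / (1 + (cmod w)\<^sup>2)"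
    have u: "(1 + (Re z)\<^sup>2 + (Im z)\<^sup>2) * u = 1"
      using one_plus_cmod_pos[of z] by (simp add: u_def cmod_power2)
    have v: "(1 + (Re w)\<^sup>2 + (Im w)\<^sup>2) * v = 1"
      using one_plus_cmod_pos[of w] by (simp add: v_def cmod_power2)
    have "(2 * Re z * u - 2 * Re w * v)\<^sup>2 + ((2 * Im z * u - 2 * Im w * v)\<^sup>2 + (2 * v - 2 * u)\<^sup>2)
            = 4 * (u * ((1 + (Re z)\<^sup>2 + (Im z)\<^sup>2) * u) + v * ((1 + (Re w)\<^sup>2 + (Im w)\<^sup>2) * v)
                - 2 * u * v * (Re z * Re w + Im z * Im w + 1))"
      by (simp add: power2_eq_square algebra_simps)
    also have "\<dots> = 4 * (((1 + (Re w)\<^sup>2 + (Im w)\<^sup>2) * v) * u + ((1 + (Re z)\<^sup>2 + (Im z)\<^sup>2) * u) * v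
                - 2 * u * v * (Re z * Re w + Im z * Im w + 1))"
      unfolding u v by simp
    also have "\<dots> = 4 * ((Re z - Re w)\<^sup>2 + (Im z - Im w)\<^sup>2) * (u * v)"
      by (simp add: power2_eq_square algebra_simps)
    also have "\<dots> = 4 * (cmod (z - w))\<^sup>2 * (u * v)"
      by (simp add: cmod_power2)
    finally have "dist (stereo (Fin z)) (stereo (Fin w)) = sqrt (4 * (cmod (z - w))\<^sup>2 * (u * v))"
      by (simp add: dist_prod_def dist_real_def u_def v_def)
    then show ?thesis
      by (simp add: u_def v_def real_sqrt_mult real_sqrt_divide)
  qed
  show ?thesis
    by (cases p; cases q) (simp_all only: chordal.simps FF FI dist_self dist_commute)
qed

lemma inj_stereo: "stereo p = stereo q \<Longrightarrow> p = q"
proof -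
  assume "stereo p = stereo q"
  then have 0: "chordal p q = 0" by (simp add: chordal_eq_dist_stereo)
  have nz: "sqrt (1 + (cmod z)\<^sup>2) \<noteq> 0" for z
    using one_plus_cmod_pos[of z] by simp
  show "p = q"
    using 0 nz by (cases p; cases q) (auto simp del: real_sqrt_eq_zero_cancel_iff)
qed

instantiation csphere :: metric_space
begin

definition dist_csphere :: "csphere \<Rightarrow> csphere \<Rightarrow> real" where
  "dist_csphere = chordal"

definition uniformity_csphere :: "(csphere \<times> csphere) filter" where
  "uniformity_csphere = (INF e\<in>{0<..}. principal {(x, y). dist x y < e})"

definition open_csphere :: "csphere set \<Rightarrow> bool" where
  "open_csphere U \<longleftrightarrow> (\<forall>x\<in>U. eventually (\<lambda>(x', y). x' = x \<longrightarrow> y \<in> U) uniformity)"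

instance
proof
  fix x y z :: csphere
  show "dist x y = 0 \<longleftrightarrow> x = y"
    by (auto simp: dist_csphere_def chordal_eq_dist_stereo intro: inj_stereo)
  show "dist x y \<le> dist x z + dist y z"
    by (simp add: dist_csphere_def chordal_eq_dist_stereo dist_triangle2)
qed (simp_all add: uniformity_csphere_def open_csphere_def)

end

text \<open>The upper half-plane and its ideal boundary, as subsets of the sphere.\<close>

definition upper_half_plane :: "csphere set" where
  "upper_half_plane = {Fin z | z. 0 < Im z}"

definition ideal_boundary :: "csphere set" where
  "ideal_boundary = insert Infty {Fin (of_real x) | x. True}"


section \<open>The topological group of real Moebius transformations\<close>

definition real_moebius :: "real^2^2 \<Rightarrow> csphere \<Rightarrow> csphere" where
  "real_moebius A p =
     (let a = complex_of_real (A $ 1 $ 1); b = complex_of_real (A $ 1 $ 2);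
          c = complex_of_real (A $ 2 $ 1); d = complex_of_real (A $ 2 $ 2)
      in case p of
           Fin z \<Rightarrow> if c * z + d = 0 then Infty else Fin ((a * z + b) / (c * z + d))
         | Infty \<Rightarrow> if c = 0 then Infty else Fin (a / c))"

definition moebius_group :: "(csphere \<Rightarrow> csphere) monoid" where
  "moebius_group = \<lparr>carrier = {real_moebius A | A. det A > 0}, mult = (\<circ>), one = id\<rparr>"

text \<open>The topology is that of PSL(2,R), i.e. the quotient topology with respect to the
  map from SL(2,R), a subspace of the Euclidean space of matrices; see
  \<open>quotient_map_real_moebius\<close> below.\<close>

definition SL2 :: "(real^2^2) set" where
  "SL2 = {A. det A = 1}"

definition moebius_topology :: "(csphere \<Rightarrow> csphere) topology" where
  "moebius_topology =
     topology (\<lambda>U. U \<subseteq> carrier moebius_group \<and>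
                   openin (top_of_set SL2) {A \<in> SL2. real_moebius A \<in> U})"

lemma real_moebius_scale:
  assumes "k \<noteq> 0" shows "real_moebius (k *\<^sub>R A) = real_moebius A"
proof
  fix p
  have 1: "(of_real k * c * z + of_real k * d = 0) = (c * z + d = 0)" for c d z :: complex
    using assms by (metis (no_types, lifting) distrib_left mult.assoc mult_eq_0_iff of_real_eq_0_iff)
  have 2: "(of_real k * a * z + of_real k * b) / (of_real k * c * z + of_real k * d)
      = (a * z + b) / (c * z + d)" for a b c d z :: complex
    using assms by (metis (no_types, lifting) distrib_left mult.assoc
        mult_divide_mult_cancel_left of_real_eq_0_iff)
  show "real_moebius (k *\<^sub>R A) p = real_moebius A p"
    using assms by (cases p) (auto simp: real_moebius_def Let_def 1 2)
qed

lemma carrier_moebius_group_eq: "carrier moebius_group = real_moebius ` SL2"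
proof -
  have "\<exists>B\<in>SL2. real_moebius A = real_moebius B" if "det A > 0" for A
  proof (intro bexI)
    let ?k = "1 / sqrt (det A)"
    show "real_moebius A = real_moebius (?k *\<^sub>R A)" using that by (simp add: real_moebius_scale)
    have "det (k *\<^sub>R A) = k\<^sup>2 * det A" for k
      by (simp add: det_2 power2_eq_square algebra_simps)
    then have "det (?k *\<^sub>R A) = ?k\<^sup>2 * det A" .
    also have "\<dots> = 1" using that by (simp add: power_divide)
    finally show "?k *\<^sub>R A \<in> SL2" by (simp add: SL2_def)
  qed
  then show ?thesis
    by (fastforce simp: moebius_group_def SL2_def)
qed

lemma openin_moebius_topology:
  "openin moebius_topology U \<longleftrightarrow>
     U \<subseteq> carrier moebius_group \<and> openin (top_of_set SL2) {A \<in> SL2. real_moebius A \<in> U}"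
proof -
  let ?P = "\<lambda>U. U \<subseteq> carrier moebius_group \<and> openin (top_of_set SL2) {A \<in> SL2. real_moebius A \<in> U}"
  have "istopology ?P"
    unfolding istopology_def
  proof (intro conjI allI impI)
    fix S T assume S: "?P S" and T: "?P T"
    have "{A \<in> SL2. real_moebius A \<in> S \<inter> T} = {A \<in> SL2. real_moebius A \<in> S} \<inter> {A \<in> SL2. real_moebius A \<in> T}"
      by auto
    then show "openin (top_of_set SL2) {A \<in> SL2. real_moebius A \<in> S \<inter> T}"
      using S T by (simp only: openin_Int)
    show "S \<inter> T \<subseteq> carrier moebius_group" using S by auto
  next
    fix K assume K: "\<forall>S\<in>K. ?P S"
    have "{A \<in> SL2. real_moebius A \<in> \<Union>K} = \<Union>((\<lambda>S. {A \<in> SL2. real_moebius A \<in> S}) ` K)"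
      by auto
    then show "openin (top_of_set SL2) {A \<in> SL2. real_moebius A \<in> \<Union>K}"
      using K by (auto simp only: intro!: openin_Union)
    show "\<Union>K \<subseteq> carrier moebius_group" using K by auto
  qed
  then show ?thesis
    by (simp add: moebius_topology_def topology_inverse')
qed

lemma topspace_moebius_topology: "topspace moebius_topology = carrier moebius_group"
proof -
  have "{A \<in> SL2. real_moebius A \<in> carrier moebius_group} = SL2"
    by (auto simp: carrier_moebius_group_eq)
  then have "openin moebius_topology (carrier moebius_group)"
    by (simp add: openin_moebius_topology)
  then show ?thesis
    by (intro subset_antisym openin_subset) (use openin_moebius_topology openin_topspace in blast)
qed

lemma quotient_map_real_moebius: "quotient_map (top_of_set SL2) moebius_topology real_moebius"
  unfolding quotient_map_def topspace_moebius_topology openin_moebius_topology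
  by (simp add: carrier_moebius_group_eq)

lemma real_moebius_mat_1: "real_moebius (mat 1) = id"
proof
  fix p show "real_moebius (mat 1) p = id p"
    by (cases p) (auto simp: real_moebius_def mat_def)
qed

lemma real_moebius_mult:
  assumes "det A \<noteq> 0" "det B \<noteq> 0"
  shows "real_moebius (A ** B) = real_moebius A \<circ> real_moebius B"
proof
  fix p
  define a b c d where
    "a = complex_of_real (A $ 1 $ 1)" and "b = complex_of_real (A $ 1 $ 2)"
    and "c = complex_of_real (A $ 2 $ 1)" and "d = complex_of_real (A $ 2 $ 2)"
  define a' b' c' d' where
    "a' = complex_of_real (B $ 1 $ 1)" and "b' = complex_of_real (B $ 1 $ 2)"
    and "c' = complex_of_real (B $ 2 $ 1)" and "d' = complex_of_real (B $ 2 $ 2)"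
  note defs = a_def b_def c_def d_def a'_def b'_def c'_def d'_def
  have "complex_of_real (det B) \<noteq> 0" using assms by simp
  then have B: "a' * d' - b' * c' \<noteq> 0" by (simp add: det_2 defs)
  have AB: "complex_of_real ((A ** B) $ 1 $ 1) = a * a' + b * c'"
    "complex_of_real ((A ** B) $ 1 $ 2) = a * b' + b * d'"
    "complex_of_real ((A ** B) $ 2 $ 1) = c * a' + d * c'"
    "complex_of_real ((A ** B) $ 2 $ 2) = c * b' + d * d'"
    by (simp_all add: matrix_matrix_mult_def sum_2 defs)
  show "real_moebius (A ** B) p = (real_moebius A \<circ> real_moebius B) p"
  proof (cases p)
    case (Fin z)
    define u v where "u = a' * z + b'" and "v = c' * z + d'"
    have num: "(a * a' + b * c') * z + (a * b' + b * d') = a * u + b * v"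
      and den: "(c * a' + d * c') * z + (c * b' + d * d') = c * u + d * v"
      by (simp_all add: u_def v_def algebra_simps)
    have L: "real_moebius (A ** B) p
        = (if c * u + d * v = 0 then Infty else Fin ((a * u + b * v) / (c * u + d * v)))"
      by (simp add: Fin real_moebius_def AB num den)
    show ?thesis
    proof (cases "v = 0")
      case True
      have "u \<noteq> 0"
      proof
        assume "u = 0"
        then have "a' * v - c' * u = 0" using True by simp
        moreover have "a' * v - c' * u = a' * d' - b' * c'"
          by (simp add: u_def v_def algebra_simps)
        ultimately show False using B by simp
      qed
      moreover have "real_moebius B p = Infty"
        using True by (simp add: Fin real_moebius_def v_def defs)
      ultimately show ?thesis
        using True L by (simp add: real_moebius_def defs)
    next
      case False
      have "real_moebius B p = Fin (u / v)"
        using False by (simp add: Fin real_moebius_def u_def v_def defs)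
      moreover have "(c * (u / v) + d = 0) = (c * u + d * v = 0)"
        "(a * (u / v) + b) / (c * (u / v) + d) = (a * u + b * v) / (c * u + d * v)"
        using False by (simp_all add: divide_simps)
      ultimately show ?thesis
        by (simp add: L real_moebius_def[of A] flip: defs)
    qed
  next
    case Infty
    have L: "real_moebius (A ** B) p
        = (if c * a' + d * c' = 0 then Infty else Fin ((a * a' + b * c') / (c * a' + d * c')))"
      by (simp add: Infty real_moebius_def Let_def AB del: of_real_eq_0_iff)
    show ?thesis
    proof (cases "c' = 0")
      case True
      then have "a' \<noteq> 0" using B by auto
      moreover have "real_moebius B p = Infty"
        using True by (simp add: Infty real_moebius_def defs)
      ultimately show ?thesis
        using True L by (simp add: real_moebius_def defs)
    next
      case False
      have "real_moebius B p = Fin (a' / c')"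
        using False by (simp add: Infty real_moebius_def defs)
      moreover have "(c * (a' / c') + d = 0) = (c * a' + d * c' = 0)"
        "(a * (a' / c') + b) / (c * (a' / c') + d) = (a * a' + b * c') / (c * a' + d * c')"
        using False by (simp_all add: divide_simps)
      ultimately show ?thesis
        by (simp add: L real_moebius_def[of A] flip: defs)
    qed
  qed
qed

lemma group_moebius_group: "group moebius_group"
proof (rule groupI)
  fix f g assume "f \<in> carrier moebius_group" "g \<in> carrier moebius_group"
  then obtain A B where "f = real_moebius A" "det A > 0" "g = real_moebius B" "det B > 0"
    by (auto simp: moebius_group_def)
  then have "f \<circ> g = real_moebius (A ** B)" "det (A ** B) > 0"
    by (simp_all add: real_moebius_mult det_mul)
  then show "f \<otimes>\<^bsub>moebius_group\<^esub> g \<in> carrier moebius_group"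
    by (auto simp: moebius_group_def)
next
  have "det (mat 1 :: real^2^2) > 0" by simp
  then show "\<one>\<^bsub>moebius_group\<^esub> \<in> carrier moebius_group"
    by (auto simp: moebius_group_def intro!: exI[of _ "mat 1 :: real^2^2"] real_moebius_mat_1[symmetric])
next
  fix f assume "f \<in> carrier moebius_group"
  then obtain A where A: "f = real_moebius A" "det A > 0"
    by (auto simp: moebius_group_def)
  then have "invertible A" by (simp add: invertible_det_nz)
  then obtain B where B: "B ** A = mat 1" by (auto simp: invertible_def)
  then have "det B * det A = 1" by (metis det_I det_mul)
  then have dB: "det B > 0" using A by (metis zero_less_mult_pos2 zero_less_one)
  have "real_moebius B \<circ> f = id"
    using A dB B by (metis real_moebius_mat_1 real_moebius_mult less_irrefl)
  then show "\<exists>g\<in>carrier moebius_group. g \<otimes>\<^bsub>moebius_group\<^esub> f = \<one>\<^bsub>moebius_group\<^esub>"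
    using dB by (auto simp: moebius_group_def)
qed (auto simp: moebius_group_def)


section \<open>Semigroups and their limit sets\<close>

definition moebius_semigroup :: "(csphere \<Rightarrow> csphere) set \<Rightarrow> bool" where
  "moebius_semigroup S \<longleftrightarrow>
     S \<noteq> {} \<and> S \<subseteq> carrier moebius_group \<and> (\<forall>f\<in>S. \<forall>g\<in>S. f \<circ> g \<in> S)"

inductive_set compositions :: "('a \<Rightarrow> 'a) set \<Rightarrow> ('a \<Rightarrow> 'a) set" for F where
  base: "f \<in> F \<Longrightarrow> f \<in> compositions F"
| comp: "f \<in> compositions F \<Longrightarrow> g \<in> compositions F \<Longrightarrow> f \<circ> g \<in> compositions F"

definition finitely_generated :: "('a \<Rightarrow> 'a) set \<Rightarrow> bool" where
  "finitely_generated S \<longleftrightarrow> (\<exists>F. finite F \<and> F \<subseteq> S \<and> S \<subseteq> compositions F)"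

definition semidiscrete :: "(csphere \<Rightarrow> csphere) set \<Rightarrow> bool" where
  "semidiscrete S \<longleftrightarrow> id \<notin> moebius_topology derived_set_of S"

definition forward_limit_set :: "(csphere \<Rightarrow> csphere) set \<Rightarrow> csphere set" where
  "forward_limit_set S = {x \<in> ideal_boundary. x islimpt (\<lambda>g. g (Fin \<i>)) ` S}"

text \<open>The base point i is immaterial: see \<open>forward_limit_set_base_point\<close> below.\<close>

definition backward_limit_set :: "(csphere \<Rightarrow> csphere) set \<Rightarrow> csphere set" where
  "backward_limit_set S = forward_limit_set ((\<lambda>g. inv\<^bsub>moebius_group\<^esub> g) ` S)"

lemma real_moebius_upper_half_plane:
  assumes "A \<in> SL2" "0 < Im w" "0 < Im w'"
  obtains z z' where "real_moebius A (Fin w) = Fin z" "real_moebius A (Fin w') = Fin z'"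
    "0 < Im z" "0 < Im z'"
    "(cmod (z - z'))\<^sup>2 / (Im z * Im z') = (cmod (w - w'))\<^sup>2 / (Im w * Im w')"
proof -
  define a b c d where "a = A $ 1 $ 1" and "b = A $ 1 $ 2" and "c = A $ 2 $ 1" and "d = A $ 2 $ 2"
  have det: "a * d - b * c = 1"
    using assms(1) by (simp add: SL2_def det_2 a_def b_def c_def d_def)
  then have detC: "of_real a * of_real d - of_real b * of_real c = (1::complex)"
    by (metis of_real_1 of_real_diff of_real_mult)
  define f where "f u = (of_real a * u + of_real b) / (of_real c * u + of_real d)" for u :: complex
  have nz: "of_real c * u + of_real d \<noteq> 0" if "0 < Im u" for u
  proof
    assume 0: "of_real c * u + of_real d = 0"
    then have "c * Im u = 0" by (auto simp: complex_eq_iff)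
    with that have "c = 0" by simp
    with 0 have "d = 0" by (simp add: complex_eq_iff)
    with \<open>c = 0\<close> det show False by simp
  qed
  have val: "real_moebius A (Fin u) = Fin (f u)" if "0 < Im u" for u
    using nz[OF that] by (simp add: real_moebius_def f_def a_def b_def c_def d_def)
  have im: "Im (f u) = Im u / (cmod (of_real c * u + of_real d))\<^sup>2" if "0 < Im u" for u
  proof -
    have "Im (f u) = ((a * d - b * c) * Im u) / (cmod (of_real c * u + of_real d))\<^sup>2"
      by (simp add: f_def Im_divide cmod_power2 algebra_simps)
    with det show ?thesis by simp
  qed
  have diff: "f w - f w' = (w - w') / ((of_real c * w + of_real d) * (of_real c * w' + of_real d))"
  proof -
    have "(of_real a * w + of_real b) * (of_real c * w' + of_real d)
          - (of_real a * w' + of_real b) * (of_real c * w + of_real d)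
        = (of_real a * of_real d - of_real b * of_real c) * (w - w')"
      by (simp add: algebra_simps)
    then show ?thesis
      using nz[OF assms(2)] nz[OF assms(3)] detC by (simp add: f_def diff_frac_eq)
  qed
  have pos: "0 < Im (f u)" if "0 < Im u" for u
    using that nz[OF that] by (simp add: im)
  have "(cmod (f w - f w'))\<^sup>2 / (Im (f w) * Im (f w')) = (cmod (w - w'))\<^sup>2 / (Im w * Im w')"
    using nz[OF assms(2)] nz[OF assms(3)]
    by (simp add: im assms diff norm_divide norm_mult power_divide power_mult_distrib)
  then show thesis
    by (rule that[OF val[OF assms(2)] val[OF assms(3)] pos[OF assms(2)] pos[OF assms(3)]])
qed

lemma chordal_power2:
  assumes "0 < Im z" "0 < Im z'"
  shows "(dist (Fin z) (Fin z'))\<^sup>2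
    = (cmod (z - z'))\<^sup>2 / (Im z * Im z')
        * (fst (snd (stereo (Fin z))) * fst (snd (stereo (Fin z'))))"
proof -
  have "(dist (Fin z) (Fin z'))\<^sup>2
      = 4 * (cmod (z - z'))\<^sup>2 / ((1 + (cmod z)\<^sup>2) * (1 + (cmod z')\<^sup>2))"
    using one_plus_cmod_pos[of z] one_plus_cmod_pos[of z']
    by (simp add: dist_csphere_def power_divide power_mult_distrib)
  then show ?thesis using assms by simp
qed

lemma abs_stereo_le_1: "\<bar>fst (snd (stereo p))\<bar> \<le> 1"
proof (cases p)
  case (Fin z)
  have "2 * \<bar>Im z\<bar> \<le> 1 + (Im z)\<^sup>2"
    using sum_squares_bound[of 1 "\<bar>Im z\<bar>"] by simp
  also have "\<dots> \<le> 1 + (cmod z)\<^sup>2" by (simp add: cmod_power2)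
  finally show ?thesis
    using one_plus_cmod_pos[of z] by (simp add: Fin abs_mult divide_le_eq_1)
qed simp

lemma tendsto_stereo: "(f \<longlongrightarrow> x) F \<Longrightarrow> ((\<lambda>n. stereo (f n)) \<longlongrightarrow> stereo x) F"
  by (simp add: tendsto_iff dist_csphere_def chordal_eq_dist_stereo)

lemma islimpt_orbit_base_point:
  assumes S: "S \<subseteq> carrier moebius_group" and w: "0 < Im w" "0 < Im w'"
    and x: "x \<in> ideal_boundary" and lim: "x islimpt (\<lambda>g. g (Fin w)) ` S"
  shows "x islimpt (\<lambda>g. g (Fin w')) ` S"
proof -
  obtain f where f: "\<And>n. f n \<in> (\<lambda>g. g (Fin w)) ` S - {x}" and fx: "f \<longlonglongrightarrow> x"
    using lim unfolding islimpt_sequential by blast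
  have "\<exists>g. g \<in> S \<and> f n = g (Fin w)" for n using f[of n] by auto
  then obtain g where g: "\<And>n. g n \<in> S" "\<And>n. f n = g n (Fin w)" by metis
  define s where "s p = fst (snd (stereo p))" for p
  define K where "K = (cmod (w - w'))\<^sup>2 / (Im w * Im w')"
  have K: "K \<ge> 0" using w by (simp add: K_def)
  have key: "g n (Fin w') \<noteq> x \<and> (dist (f n) (g n (Fin w')))\<^sup>2 \<le> K * \<bar>s (f n)\<bar>" for n
  proof -
    obtain A where A: "A \<in> SL2" "g n = real_moebius A"
      using g(1)[of n] S carrier_moebius_group_eq by auto
    obtain z z' where z: "g n (Fin w) = Fin z" "g n (Fin w') = Fin z'" "0 < Im z" "0 < Im z'"
      "(cmod (z - z'))\<^sup>2 / (Im z * Im z') = K"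
      using real_moebius_upper_half_plane[OF A(1) w] A(2) unfolding K_def by metis
    have "(dist (f n) (g n (Fin w')))\<^sup>2 = K * (s (f n) * s (Fin z'))"
      using chordal_power2[OF z(3,4)] by (simp only: g(2) z s_def)
    also have "\<dots> \<le> K * \<bar>s (f n) * s (Fin z')\<bar>"
      using K by (intro mult_left_mono) auto
    also have "\<bar>s (f n) * s (Fin z')\<bar> \<le> \<bar>s (f n)\<bar>"
      unfolding abs_mult using abs_stereo_le_1[of "Fin z'"] by (intro mult_left_le) (auto simp: s_def)
    finally have "(dist (f n) (g n (Fin w')))\<^sup>2 \<le> K * \<bar>s (f n)\<bar>"
      using K by (simp add: mult_left_mono)
    moreover have "Fin z' \<noteq> x"
      using z(4) x by (auto simp: ideal_boundary_def)
    ultimately show ?thesis using z by simp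
  qed
  have "s x = 0" using x by (auto simp: ideal_boundary_def s_def)
  moreover have "(\<lambda>n. s (f n)) \<longlonglongrightarrow> s x"
    unfolding s_def by (intro tendsto_fst tendsto_snd tendsto_stereo fx)
  ultimately have "(\<lambda>n. K * \<bar>s (f n)\<bar>) \<longlonglongrightarrow> 0"
    using tendsto_mult_right_zero tendsto_rabs_zero by fastforce
  then have "(\<lambda>n. (dist (f n) (g n (Fin w')))\<^sup>2) \<longlonglongrightarrow> 0"
    by (rule tendsto_sandwich[OF _ _ tendsto_const, rotated 2]) (use key in auto)
  then have d: "(\<lambda>n. dist (f n) (g n (Fin w'))) \<longlonglongrightarrow> 0"
    using tendsto_real_sqrt[of "\<lambda>n. (dist (f n) (g n (Fin w')))\<^sup>2" 0] by simp
  have "(\<lambda>n. dist (f n) x + dist (f n) (g n (Fin w'))) \<longlonglongrightarrow> 0"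
    using tendsto_add[OF fx[THEN tendsto_dist_iff[THEN iffD1]] d] by simp
  then have "(\<lambda>n. dist (g n (Fin w')) x) \<longlonglongrightarrow> 0"
  proof (rule Lim_null_comparison[rotated])
    show "\<forall>\<^sub>F n in sequentially.
            norm (dist (g n (Fin w')) x) \<le> dist (f n) x + dist (f n) (g n (Fin w'))"
    proof (intro always_eventually allI)
      show "norm (dist (g n (Fin w')) x) \<le> dist (f n) x + dist (f n) (g n (Fin w'))" for n
        using dist_triangle3[of "g n (Fin w')" x "f n"] by simp
    qed
  qed
  then have "(\<lambda>n. g n (Fin w')) \<longlonglongrightarrow> x"
    by (rule tendsto_dist_iff[THEN iffD2])
  then show ?thesis
    unfolding islimpt_sequential using g(1) key by (intro exI[of _ "\<lambda>n. g n (Fin w')"]) auto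
qed

lemma forward_limit_set_base_point:
  assumes "S \<subseteq> carrier moebius_group" "w \<in> upper_half_plane"
  shows "forward_limit_set S = {x \<in> ideal_boundary. x islimpt (\<lambda>g. g w) ` S}"
proof -
  obtain u where "w = Fin u" "0 < Im u"
    using assms(2) by (auto simp: upper_half_plane_def)
  then show ?thesis
    using islimpt_orbit_base_point[OF assms(1), of \<i> u] islimpt_orbit_base_point[OF assms(1), of u \<i>]
    by (auto simp: forward_limit_set_def)
qed

end

theory Submission
  imports Defs
begin

text \<open>Lift the generators to \<open>SL2\<close> and let \<open>M\<close> be the matrix semigroup that they generate. If \<open>t \<in> M\<close> has
  no inverse in \<open>S\<close>, semidiscreteness yields \<open>u\<^sub>n \<in> M\<close> with \<open>|u\<^sub>n| \<le> n < |u\<^sub>n s t|\<close> for all \<open>s \<in> M\<close>. The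
  points \<open>u\<^sub>n\<^sup>-\<^sup>1 i\<close> accumulate at a backward limit point that is the centre of a horoball missed by the
  orbit \<open>S i\<close>. The set of such backward limit points is invariant under \<open>S\<^sup>-\<^sup>1\<close>. It has at most two
  elements: as \<open>S\<close> is finitely generated, \<open>u\<^sub>n S i\<close> moves in bounded steps, it is far away from \<open>i\<close>,
  and it accumulates at every point of \<open>\<Lambda>\<^sup>-(S) \<subseteq> \<Lambda>\<^sup>+(S)\<close>; given three such points it would have to
  cross, far away from \<open>i\<close>, a geodesic joining two of them, and so enter one of the missed horoballs.
  If there is one such point, it is fixed by \<open>S\<close>, which cannot expand towards it, and \<open>\<Lambda>\<^sup>-(S)\<close> has no
  other point. If there are two, \<open>S\<close> preserves the geodesic joining them and \<open>S i\<close> is bounded.\<close>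

section \<open>Two-by-two matrices\<close>

text \<open>The adjugate: on \<open>SL2\<close> it is the inverse, and it is linear in the entries
  and keeps the norm.\<close>

definition adj2 :: "real^2^2 \<Rightarrow> real^2^2" where
  "adj2 A = vector [vector [A$2$2, - A$1$2], vector [- A$2$1, A$1$1]]"

text \<open>The determinant with columns \<open>x\<close> and \<open>y\<close>. It is invariant
  under \<open>SL2\<close>; for nonzero vectors it vanishes exactly when they give the same boundary
  point.\<close>

definition cross2 :: "real^2 \<Rightarrow> real^2 \<Rightarrow> real" where
  "cross2 x y = x$1 * y$2 - x$2 * y$1"

lemma adj2_nth [simp]:
  "adj2 A $ 1 $ 1 = A$2$2" "adj2 A $ 1 $ 2 = - A$1$2"
  "adj2 A $ 2 $ 1 = - A$2$1" "adj2 A $ 2 $ 2 = A$1$1"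
  by (simp_all add: adj2_def vector_2)

lemma adj2_adj2 [simp]: "adj2 (adj2 A) = A"
  by (simp add: vec_eq_iff forall_2)

lemma det_adj2 [simp]: "det (adj2 A) = det A"
  by (simp add: det_2)

lemma adj2_SL2: "adj2 A \<in> SL2 \<longleftrightarrow> A \<in> SL2"
  by (simp add: SL2_def)

lemma mult_SL2: "A \<in> SL2 \<Longrightarrow> B \<in> SL2 \<Longrightarrow> A ** B \<in> SL2"
  by (simp add: SL2_def det_mul)

lemma mat22_mult_nth:
  fixes A B :: "real^2^2"
  shows "(A ** B) $ i $ j = A$i$1 * B$1$j + A$i$2 * B$2$j"
  by (simp add: matrix_matrix_mult_def sum_2)

lemma mat22_vec_nth:
  fixes A :: "real^2^2"
  shows "(A *v x) $ i = A$i$1 * x$1 + A$i$2 * x$2"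
  by (simp add: matrix_vector_mult_def sum_2)

lemma adj2_mult: "adj2 (A ** B) = adj2 B ** adj2 A"
  by (simp add: vec_eq_iff forall_2 mat22_mult_nth algebra_simps)

lemma adj2_left: "A \<in> SL2 \<Longrightarrow> adj2 A ** A = mat 1"
  by (simp add: vec_eq_iff forall_2 mat22_mult_nth mat_def SL2_def det_2 algebra_simps)

lemma adj2_right: "A \<in> SL2 \<Longrightarrow> A ** adj2 A = mat 1"
  using adj2_left[of "adj2 A"] by (simp add: adj2_SL2)

lemma norm_vec2: "(norm x)\<^sup>2 = (x$1)\<^sup>2 + (x$2)\<^sup>2" for x :: "real^2"
  by (simp add: norm_vec_def L2_set_def sum_2)

text \<open>This is the Frobenius norm; on \<open>SL2\<close> its square is 2 cosh of the hyperbolic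
  distance from i to A i.\<close>

lemma norm_mat22:
  "(norm A)\<^sup>2 = (A$1$1)\<^sup>2 + (A$1$2)\<^sup>2 + (A$2$1)\<^sup>2 + (A$2$2)\<^sup>2" for A :: "real^2^2"
proof -
  have "(norm A)\<^sup>2 = (norm (A$1))\<^sup>2 + (norm (A$2))\<^sup>2"
    by (simp add: norm_vec_def[of A] L2_set_def sum_2)
  then show ?thesis by (simp add: norm_vec2)
qed

lemma norm_adj2 [simp]: "norm (adj2 A) = norm A"
proof -
  have "(norm (adj2 A))\<^sup>2 = (norm A)\<^sup>2" by (simp add: norm_mat22)
  then show ?thesis by simp
qed

lemma norm_mat_vec_le: "norm (A *v x) \<le> norm A * norm x" for A :: "real^2^2"
proof (rule power2_le_imp_le)
  \<comment> \<open>Lagrange's identity: the Cauchy-Schwarz defect of each row is a square.\<close>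
  have "(norm A * norm x)\<^sup>2 - (norm (A *v x))\<^sup>2
      = (A$1$1 * x$2 - A$1$2 * x$1)\<^sup>2 + (A$2$1 * x$2 - A$2$2 * x$1)\<^sup>2"
    unfolding power_mult_distrib norm_mat22 norm_vec2
    by (simp add: mat22_vec_nth power2_eq_square algebra_simps)
  then show "(norm (A *v x))\<^sup>2 \<le> (norm A * norm x)\<^sup>2"
    by (smt (verit) zero_le_power2)
qed simp

lemma norm_mat_mult_le: "norm (A ** B) \<le> norm A * norm B" for A B :: "real^2^2"
proof (rule power2_le_imp_le)
  have "(norm A * norm B)\<^sup>2 - (norm (A ** B))\<^sup>2
      = (A$1$1 * B$2$1 - A$1$2 * B$1$1)\<^sup>2 + (A$1$1 * B$2$2 - A$1$2 * B$1$2)\<^sup>2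
      + (A$2$1 * B$2$1 - A$2$2 * B$1$1)\<^sup>2 + (A$2$1 * B$2$2 - A$2$2 * B$1$2)\<^sup>2"
    unfolding power_mult_distrib norm_mat22
    by (simp add: mat22_mult_nth power2_eq_square algebra_simps)
  then show "(norm (A ** B))\<^sup>2 \<le> (norm A * norm B)\<^sup>2"
    by (smt (verit) zero_le_power2)
qed simp

lemma norm_SL2_pos: "A \<in> SL2 \<Longrightarrow> 0 < norm A"
  by (auto simp: SL2_def det_2)

lemma adj2_mult_vec: "adj2 (A ** B) *v x = adj2 B *v (adj2 A *v x)"
  by (simp add: adj2_mult matrix_vector_mul_assoc)

lemma norm_le_mult_SL2: "A \<in> SL2 \<Longrightarrow> norm x \<le> norm A * norm (A *v x)"
  using norm_mat_vec_le[of "adj2 A" "A *v x"]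
  by (simp add: matrix_vector_mul_assoc adj2_left)

lemma mat_vec_nonzero_SL2: "A \<in> SL2 \<Longrightarrow> x \<noteq> 0 \<Longrightarrow> A *v x \<noteq> 0"
  using norm_le_mult_SL2[of A x] by force

lemma cross2_mat_vec: "cross2 (A *v x) (A *v y) = det A * cross2 x y"
  by (simp add: cross2_def mat22_vec_nth det_2 algebra_simps)

lemma cross2_adj2: "A \<in> SL2 \<Longrightarrow> cross2 (adj2 A *v x) (adj2 A *v y) = cross2 x y"
  by (simp add: cross2_mat_vec SL2_def)

lemma inner_vec2: "x \<bullet> y = x$1 * y$1 + x$2 * y$2" for x y :: "real^2"
  by (simp add: inner_vec_def sum_2)

lemma cross2_inner: "(x \<bullet> y)\<^sup>2 + (cross2 x y)\<^sup>2 = (norm x)\<^sup>2 * (norm y)\<^sup>2"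
  unfolding norm_vec2 by (simp add: inner_vec2 cross2_def power2_eq_square algebra_simps)

lemma abs_cross2_le: "\<bar>cross2 x y\<bar> \<le> norm x * norm y"
proof (rule power2_le_imp_le)
  show "\<bar>cross2 x y\<bar>\<^sup>2 \<le> (norm x * norm y)\<^sup>2"
    using cross2_inner[of x y] by (simp add: power_mult_distrib) (smt (verit) zero_le_power2)
qed simp

text \<open>A matrix is controlled by its values on a basis: if \<open>X\<close> has columns
  \<open>x\<close> and \<open>y\<close>, then B X times the adjugate of \<open>X\<close> is det X
  times \<open>B\<close>.\<close>

lemma norm_mat_le_basis:
  "\<bar>cross2 x y\<bar> * norm B \<le> (norm (B *v x) + norm (B *v y)) * (norm x + norm y)"
  for B :: "real^2^2"
proof -
  define X :: "real^2^2" where "X = vector [vector [x$1, y$1], vector [x$2, y$2]]"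
  have X: "X$1$1 = x$1" "X$1$2 = y$1" "X$2$1 = x$2" "X$2$2 = y$2"
    by (simp_all add: X_def vector_2)
  have nX: "norm X \<le> norm x + norm y"
  proof (rule power2_le_imp_le)
    show "(norm X)\<^sup>2 \<le> (norm x + norm y)\<^sup>2"
      unfolding power2_sum norm_mat22 norm_vec2 by (simp add: X)
  qed simp
  have nBX: "norm (B ** X) \<le> norm (B *v x) + norm (B *v y)"
  proof (rule power2_le_imp_le)
    show "(norm (B ** X))\<^sup>2 \<le> (norm (B *v x) + norm (B *v y))\<^sup>2"
      unfolding power2_sum norm_mat22 norm_vec2 by (simp add: X mat22_mult_nth mat22_vec_nth)
  qed simp
  have "(B ** X) ** adj2 X = cross2 x y *\<^sub>R B"
    by (simp add: vec_eq_iff forall_2 mat22_mult_nth X cross2_def algebra_simps)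
  then have "\<bar>cross2 x y\<bar> * norm B = norm ((B ** X) ** adj2 X)" by simp
  also have "\<dots> \<le> norm (B ** X) * norm X" using norm_mat_mult_le[of "B ** X" "adj2 X"] by simp
  also have "\<dots> \<le> (norm (B *v x) + norm (B *v y)) * (norm x + norm y)"
    using nX nBX by (intro mult_mono) auto
  finally show ?thesis .
qed

lemma cross2_eq_0_imp_scaleR:
  assumes "cross2 x y = 0" "x \<noteq> 0"
  obtains k where "y = k *\<^sub>R x"
proof
  \<comment> \<open>The witness, fixed by the last line, is the coefficient of the orthogonal
    projection of \<open>y\<close> to the line of \<open>x\<close>.\<close>
  have n: "(norm x)\<^sup>2 \<noteq> 0" using assms by simp
  have "(norm x)\<^sup>2 *\<^sub>R y = (x \<bullet> y) *\<^sub>R x"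
    using assms(1) unfolding norm_vec2 vec_eq_iff forall_2 cross2_def inner_vec2
    by (simp add: power2_eq_square) algebra
  then have "(1 / (norm x)\<^sup>2) *\<^sub>R ((norm x)\<^sup>2 *\<^sub>R y) = (1 / (norm x)\<^sup>2) *\<^sub>R ((x \<bullet> y) *\<^sub>R x)"
    by simp
  then show "y = ((x \<bullet> y) / (norm x)\<^sup>2) *\<^sub>R x" using n by simp
qed

text \<open>For nonzero \<open>v\<close> every row of \<open>B\<close> is a multiple of
  \<open>v\<close> turned by a right angle, and right multiplication by \<open>s\<close> replaces
  \<open>v\<close> by \<open>adj2 s *v v\<close> in these rows.\<close>

lemma norm_mult_of_kernel:
  fixes B s :: "real^2^2"
  assumes "B *v v = 0"
  shows "norm (B ** s) * norm v = norm B * norm (adj2 s *v v)"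
proof (cases "v = 0")
  case False
  define N where "N = (v$1)\<^sup>2 + (v$2)\<^sup>2"
  have N: "N \<noteq> 0" using False norm_vec2[of v] by (simp add: N_def flip: norm_vec2)
  define k where "k i = (v$1 * B$i$2 - v$2 * B$i$1) / N" for i
  have 0: "B$i$1 * v$1 + B$i$2 * v$2 = 0" for i
    using assms mat22_vec_nth[of B v i] by simp
  have "N * B$i$1 = (v$2 * B$i$1 - v$1 * B$i$2) * v$2 \<and> N * B$i$2 = (v$1 * B$i$2 - v$2 * B$i$1) * v$1" for i
    using 0[of i] unfolding N_def by algebra
  then have B: "B$i$1 = - k i * v$2" "B$i$2 = k i * v$1" for i
    using N by (simp_all add: k_def field_simps)
  have "(norm (B ** s) * norm v)\<^sup>2 = (norm B * norm (adj2 s *v v))\<^sup>2"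
    unfolding power_mult_distrib norm_mat22 norm_vec2
    by (simp add: mat22_mult_nth mat22_vec_nth B power2_eq_square algebra_simps)
  then show ?thesis by (simp add: power2_eq_iff_nonneg)
qed (simp add: matrix_vector_mult_0_right)


section \<open>Matrix semigroups acting on directions\<close>

text \<open>For \<open>A \<in> SL2\<close> and \<open>v \<noteq> 0\<close>, the chordal distance from \<open>A i\<close> to the boundary point \<open>[v]\<close> is
  \<open>2 |A\<^sup>-\<^sup>1 v| / (|A| |v|)\<close> (see \<open>dist_boundary_point\<close>), and \<open>- 2 ln |A\<^sup>-\<^sup>1 v|\<close> is the Busemann function of
  \<open>[v]\<close> at \<open>A i\<close>. So \<open>approaches M v\<close> says that \<open>[v]\<close> is a forward limit point of \<open>M\<close>, and
  \<open>horo_avoids M v\<close> that the orbit of \<open>i\<close> misses a horoball at \<open>[v]\<close>.\<close>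

definition approaches :: "(real^2^2) set \<Rightarrow> real^2 \<Rightarrow> bool" where
  "approaches M v \<longleftrightarrow> (\<forall>e>0. \<exists>A\<in>M. norm (adj2 A *v v) < e * norm A)"

definition horo_avoids :: "(real^2^2) set \<Rightarrow> real^2 \<Rightarrow> bool" where
  "horo_avoids M v \<longleftrightarrow> (\<exists>e>0. \<forall>A\<in>M. e \<le> norm (adj2 A *v v))"

inductive_set mat_products :: "(real^2^2) set \<Rightarrow> (real^2^2) set" for G where
  base: "A \<in> G \<Longrightarrow> A \<in> mat_products G"
| mult: "A \<in> mat_products G \<Longrightarrow> B \<in> mat_products G \<Longrightarrow> A ** B \<in> mat_products G"

lemma mat_products_SL2: "G \<subseteq> SL2 \<Longrightarrow> mat_products G \<subseteq> SL2"
proof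
  show "A \<in> SL2" if "G \<subseteq> SL2" "A \<in> mat_products G" for A
    using that(2,1) by induction (auto intro: mult_SL2)
qed

lemma approaches_adj2_image:
  "approaches (adj2 ` M) v \<longleftrightarrow> (\<forall>e>0. \<exists>A\<in>M. norm (A *v v) < e * norm A)"
  by (simp add: approaches_def)

lemma approaches_scaleR:
  assumes "approaches M v"
  shows "approaches M (k *\<^sub>R v)"
  unfolding approaches_def
proof (intro allI impI)
  fix e :: real assume "e > 0"
  \<comment> \<open>Dividing by |k| + 1 instead of |k| covers \<open>k = 0\<close> as well.\<close>
  then have "e / (\<bar>k\<bar> + 1) > 0" by simp
  then obtain A where A: "A \<in> M" "norm (adj2 A *v v) < e / (\<bar>k\<bar> + 1) * norm A"
    using assms unfolding approaches_def by blast
  have "norm (adj2 A *v (k *\<^sub>R v)) = \<bar>k\<bar> * norm (adj2 A *v v)"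
    by (simp add: matrix_vector_mult_scaleR)
  also have "\<dots> \<le> (\<bar>k\<bar> + 1) * norm (adj2 A *v v)" by (simp add: mult_right_mono)
  also have "\<dots> < (\<bar>k\<bar> + 1) * (e / (\<bar>k\<bar> + 1) * norm A)"
    using A by (intro mult_strict_left_mono) auto
  also have "\<dots> = e * norm A" by (simp add: field_simps)
  finally show "\<exists>A\<in>M. norm (adj2 A *v (k *\<^sub>R v)) < e * norm A" using A by blast
qed

lemma horo_avoids_scaleR:
  assumes "horo_avoids M v" "k \<noteq> 0"
  shows "horo_avoids M (k *\<^sub>R v)"
proof -
  obtain e where "e > 0" "\<forall>A\<in>M. e \<le> norm (adj2 A *v v)"
    using assms(1) unfolding horo_avoids_def by blast
  then show ?thesis
    unfolding horo_avoids_def using assms(2)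
    by (intro exI[of _ "\<bar>k\<bar> * e"]) (simp add: matrix_vector_mult_scaleR)
qed

locale matrix_semigroup =
  fixes M :: "(real^2^2) set"
  assumes SL2: "M \<subseteq> SL2"
    and mult_closed: "A \<in> M \<Longrightarrow> B \<in> M \<Longrightarrow> A ** B \<in> M"
begin

lemma in_SL2: "A \<in> M \<Longrightarrow> A \<in> SL2"
  using SL2 by blast

lemma horo_avoids_adj2:
  assumes "horo_avoids M v" "g \<in> M"
  shows "horo_avoids M (adj2 g *v v)"
proof -
  obtain e where "e > 0" "\<forall>A\<in>M. e \<le> norm (adj2 A *v v)"
    using assms(1) unfolding horo_avoids_def by blast
  then show ?thesis
    unfolding horo_avoids_def using mult_closed[OF assms(2)] by (auto simp flip: adj2_mult_vec)
qed

text \<open>A witness \<open>B\<close> for \<open>v\<close> is replaced by \<open>B ** g\<close>,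
  which sends \<open>adj2 g *v v\<close> to \<open>B *v v\<close> and has norm at least |B| /
  |g|.\<close>

lemma approaches_adj2_image_adj2:
  assumes v: "approaches (adj2 ` M) v" and g: "g \<in> M"
  shows "approaches (adj2 ` M) (adj2 g *v v)"
  unfolding approaches_adj2_image
proof (intro allI impI)
  fix e :: real assume "e > 0"
  then have "e / norm g > 0" using norm_SL2_pos[OF in_SL2[OF g]] by simp
  then obtain B where B: "B \<in> M" "norm (B *v v) < e / norm g * norm B"
    using v unfolding approaches_adj2_image by blast
  have "norm B = norm ((B ** g) ** adj2 g)"
    using adj2_right[OF in_SL2[OF g]] by (simp flip: matrix_mul_assoc)
  also have "\<dots> \<le> norm (B ** g) * norm g"
    using norm_mat_mult_le[of "B ** g" "adj2 g"] by simp
  finally have "e / norm g * norm B \<le> e / norm g * (norm (B ** g) * norm g)"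
    using \<open>e / norm g > 0\<close> by (intro mult_left_mono) auto
  also have "\<dots> = e * norm (B ** g)" using \<open>e / norm g > 0\<close> by auto
  finally have "norm ((B ** g) *v (adj2 g *v v)) < e * norm (B ** g)"
    using B adj2_right[OF in_SL2[OF g]]
    by (simp add: matrix_vector_mul_assoc flip: matrix_mul_assoc)
  then show "\<exists>A\<in>M. norm (A *v (adj2 g *v v)) < e * norm A"
    using mult_closed[OF B(1) g] by blast
qed

text \<open>If \<open>t\<close> has no inverse in the semigroup, no right walk with infinitely many steps \<open>t\<close> can stay
  bounded: it would have a Cauchy subsequence, and the quotients of consecutive terms would
  accumulate at the identity.\<close>

lemma escaping_element:
  assumes t: "t \<in> M" and d: "d > 0" "\<And>s. s \<in> M \<Longrightarrow> d \<le> dist (s ** t) (mat 1)"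
    and R: "norm t \<le> R"
  obtains u where "u \<in> M" "norm u \<le> R" "\<And>s. s \<in> M \<Longrightarrow> R < norm (u ** s ** t)"
proof -
  have "\<exists>u\<in>M. norm u \<le> R \<and> (\<forall>s\<in>M. R < norm (u ** s ** t))"
  proof (rule ccontr)
    assume "\<not> ?thesis"
    then have "\<forall>u. \<exists>s. u \<in> M \<and> norm u \<le> R \<longrightarrow> s \<in> M \<and> norm (u ** s ** t) \<le> R"
      by force
    then obtain h where h: "\<And>u. u \<in> M \<Longrightarrow> norm u \<le> R \<Longrightarrow> h u \<in> M \<and> norm (u ** h u ** t) \<le> R"
      by metis
    define w where "w n = ((\<lambda>u. u ** h u ** t) ^^ n) t" for n
    have w_Suc: "w (Suc n) = w n ** h (w n) ** t" for n by (simp add: w_def)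
    have w: "w n \<in> M \<and> norm (w n) \<le> R" for n
    proof (induction n)
      case 0 show ?case using t R by (simp add: w_def)
    next
      case (Suc n) then show ?case using h mult_closed t by (auto simp: w_Suc)
    qed
    have quot: "\<exists>s\<in>M. w n = w m ** (s ** t)" if "m < n" for m n
      using that
    proof (induction n)
      case (Suc n)
      have hn: "h (w n) \<in> M" using h w by blast
      show ?case
      proof (cases "m = n")
        case True then show ?thesis using hn by (auto simp: w_Suc matrix_mul_assoc)
      next
        case False
        then obtain s where s: "s \<in> M" "w n = w m ** (s ** t)" using Suc by auto
        then have "w (Suc n) = w m ** ((s ** t ** h (w n)) ** t)"
          by (simp add: w_Suc[of n] matrix_mul_assoc)
        then show ?thesis using s hn t mult_closed by blast
      qed
    qed simp
    have "bounded (range w)" using w by (auto simp: bounded_iff)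
    then obtain l r where "strict_mono r" "(w \<circ> r) \<longlonglongrightarrow> l"
      using bounded_imp_convergent_subsequence by blast
    then have "Cauchy (w \<circ> r)" by (simp add: LIMSEQ_imp_Cauchy)
    have "R > 0" using R norm_SL2_pos[OF in_SL2[OF t]] by linarith
    \<comment> \<open>The factor 1 / R compensates for the norm of the inverse of
      \<open>w ?m\<close> in the quotient of two terms.\<close>
    then have "d / R > 0" using d by simp
    with \<open>Cauchy (w \<circ> r)\<close> obtain N where N: "\<forall>m\<ge>N. \<forall>n\<ge>N. dist ((w \<circ> r) m) ((w \<circ> r) n) < d / R"
      unfolding Cauchy_def by blast
    let ?m = "r N" and ?n = "r (Suc N)"
    have "?m < ?n" using \<open>strict_mono r\<close> by (simp add: strict_mono_Suc_iff)
    then obtain s where s: "s \<in> M" "w ?n = w ?m ** (s ** t)" using quot by blast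
    have wm: "w ?m \<in> SL2" using w in_SL2 by blast
    have "s ** t - mat 1 = adj2 (w ?m) ** (w ?n - w ?m)"
    proof -
      have "adj2 (w ?m) ** (w ?n - w ?m) = adj2 (w ?m) ** w ?n - adj2 (w ?m) ** w ?m"
        by (simp add: vec_eq_iff forall_2 mat22_mult_nth algebra_simps)
      then show ?thesis using s(2) adj2_left[OF wm] by (simp add: matrix_mul_assoc)
    qed
    then have "dist (s ** t) (mat 1) \<le> norm (w ?m) * norm (w ?n - w ?m)"
      using norm_mat_mult_le[of "adj2 (w ?m)" "w ?n - w ?m"] by (simp add: dist_norm)
    also have "\<dots> \<le> R * norm (w ?n - w ?m)" using w by (intro mult_right_mono) auto
    also have "\<dots> < R * (d / R)"
      using N[rule_format, of "Suc N" N] \<open>R > 0\<close> by (intro mult_strict_left_mono) (auto simp: dist_norm)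
    also have "\<dots> = d" using \<open>R > 0\<close> by simp
    finally show False using d(2)[OF s(1)] by simp
  qed
  then show thesis using that by blast
qed

end

section \<open>Semigroups with an element that has no inverse\<close>

locale noninvertible_matrix_semigroup = matrix_semigroup +
  fixes t :: "real^2^2" and d :: real
  assumes t: "t \<in> M" and d: "d > 0" "\<And>s. s \<in> M \<Longrightarrow> d \<le> dist (s ** t) (mat 1)"
begin

lemma nt_pos: "norm t > 0"
  using norm_SL2_pos in_SL2 t by blast

lemma escaping_element':
  obtains u where "u \<in> M" "R \<le> norm u" "\<And>s. s \<in> M \<Longrightarrow> R \<le> norm (u ** s)"
proof -
  \<comment> \<open>The first entry is required by \<open>escaping_element\<close>; the factors |t|
    pay for removing \<open>t\<close> from |u s t|, once for u s and, with \<open>s = t\<close>,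
    twice for \<open>u\<close>.\<close>
  define Q where "Q = Max {norm t, R * norm t, R * norm t * norm t}"
  have Q: "norm t \<le> Q" "R * norm t \<le> Q" "R * norm t * norm t \<le> Q" by (simp_all add: Q_def)
  obtain u where u: "u \<in> M" "\<And>s. s \<in> M \<Longrightarrow> Q < norm (u ** s ** t)"
    using escaping_element[OF t d Q(1)] by blast
  have us: "Q \<le> norm (u ** s) * norm t" if "s \<in> M" for s
    using u(2)[OF that] norm_mat_mult_le[of "u ** s" t] by simp
  have "R * norm t * norm t \<le> norm u * norm t * norm t"
    using us[OF t] mult_right_mono[OF norm_mat_mult_le[of u t], of "norm t"] Q(3) by simp
  then have "R \<le> norm u" using nt_pos by simp
  moreover have "R \<le> norm (u ** s)" if "s \<in> M" for s
    using us[OF that] Q(2) nt_pos by (smt (verit) mult_le_cancel_right_pos)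
  ultimately show thesis using that u(1) by blast
qed

text \<open>The direction is the kernel of a limit of normalised elements \<open>u / |u|\<close> with \<open>u\<close> as in
  \<open>escaping_element\<close>; geometrically, it is a limit of the points \<open>u\<^sup>-\<^sup>1 i\<close>.\<close>

lemma exists_horo_avoids:
  obtains v where "v \<noteq> 0" "approaches (adj2 ` M) v" "horo_avoids M v"
proof -
  \<comment> \<open>The radii start at \<open>norm t\<close>, the smallest that
    \<open>escaping_element\<close> admits.\<close>
  have "\<exists>u. u \<in> M \<and> norm u \<le> norm t + real n \<and> (\<forall>s\<in>M. norm t + real n < norm (u ** s ** t))" for n
    using escaping_element[OF t d, of "norm t + real n"] by (metis le_add_same_cancel1 of_nat_0_le_iff)
  then obtain u where u: "\<And>n. u n \<in> M" "\<And>n. norm (u n) \<le> norm t + real n"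
    "\<And>n s. s \<in> M \<Longrightarrow> norm t + real n < norm (u n ** s ** t)" by metis
  have upos: "norm (u n) > 0" for n using norm_SL2_pos in_SL2 u(1) by blast
  define b where "b n = (1 / norm (u n)) *\<^sub>R u n" for n
  have nb: "norm (b n) = 1" for n using upos[of n] by (simp add: b_def)
  then have "bounded (range b)" by (auto simp: bounded_iff)
  then obtain B r where r: "strict_mono r" and lim: "(b \<circ> r) \<longlonglongrightarrow> B"
    using bounded_imp_convergent_subsequence by blast
  have "norm B = 1"
    using tendsto_norm[OF lim] nb by (simp add: o_def LIMSEQ_const_iff)
  \<comment> \<open>Taking \<open>s = u n\<close> in the escape property forces |u n| to infinity,
    so the normalised elements have a singular limit.\<close>
  have large: "real n / norm t \<le> (norm (u n))\<^sup>2" for n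
  proof -
    have "norm t + real n < norm (u n ** u n ** t)" using u(3)[OF u(1)[of n]] by simp
    also have "\<dots> \<le> norm (u n) * norm (u n) * norm t"
      by (meson norm_mat_mult_le mult_right_mono norm_ge_zero order_trans)
    finally have "real n < (norm (u n))\<^sup>2 * norm t"
      using nt_pos unfolding power2_eq_square by linarith
    then show ?thesis using nt_pos by (simp add: pos_divide_le_eq)
  qed
  have detb: "det (b n) = 1 / (norm (u n))\<^sup>2" for n
    using in_SL2[OF u(1)[of n]] upos[of n]
    by (simp add: b_def SL2_def det_2 power2_eq_square field_simps)
  have "filterlim (\<lambda>n. real n / norm t) at_top sequentially"
    using nt_pos by (intro filterlim_at_top_mult_tendsto_pos[where f = "\<lambda>_. 1 / norm t", simplified]
        filterlim_real_sequentially tendsto_const) auto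
  then have "filterlim (\<lambda>n. (norm (u n))\<^sup>2) at_top sequentially"
    by (rule filterlim_at_top_mono) (use large in auto)
  then have "(\<lambda>n. det (b n)) \<longlonglongrightarrow> 0"
    unfolding detb by (rule real_tendsto_divide_at_top[OF tendsto_const])
  then have "(\<lambda>n. det (b (r n))) \<longlonglongrightarrow> 0"
    using LIMSEQ_subseq_LIMSEQ[OF _ r] by (auto simp: o_def)
  moreover have "(\<lambda>n. det (b (r n))) \<longlonglongrightarrow> det B"
    unfolding det_2 using lim by (intro tendsto_intros) (auto simp: o_def)
  ultimately have "det B = 0" using LIMSEQ_unique by blast
  then obtain v where v: "v \<noteq> 0" "B *v v = 0"
    using invertible_det_nz[of B] matrix_left_invertible_ker[of B] invertible_left_inverse[of B] by auto
  have "(\<lambda>n. b (r n) *v v) \<longlonglongrightarrow> B *v v"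
    by (intro vec_tendstoI) (use lim in \<open>auto simp: mat22_vec_nth o_def intro!: tendsto_intros\<close>)
  then have bv: "(\<lambda>n. norm (b (r n) *v v)) \<longlonglongrightarrow> 0"
    using tendsto_norm v by fastforce
  have "approaches (adj2 ` M) v"
    unfolding approaches_adj2_image
  proof (intro allI impI)
    fix e :: real assume "e > 0"
    with bv have "\<forall>\<^sub>F n in sequentially. norm (b (r n) *v v) < e" by (rule order_tendstoD)
    then obtain n where n: "norm (b (r n) *v v) < e" by (auto simp: eventually_sequentially)
    have "u (r n) *v v = norm (u (r n)) *\<^sub>R (b (r n) *v v)"
      using upos[of "r n"] by (simp add: b_def flip: scaleR_matrix_vector_assoc)
    then have "norm (u (r n) *v v) < e * norm (u (r n))"
      using n upos[of "r n"] by simp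
    then show "\<exists>A\<in>M. norm (A *v v) < e * norm A" using u(1) by blast
  qed
  moreover have "horo_avoids M v"
    unfolding horo_avoids_def
  proof (intro exI conjI ballI)
    show "norm v / norm t > 0" using v nt_pos by simp
    fix s assume s: "s \<in> M"
    \<comment> \<open>The same radius bounds u n from above and u n s t from below, so the
      normalised products do not shrink.\<close>
    have "1 \<le> norm (b n ** s ** t)" for n
    proof -
      have "norm (u n) \<le> norm (u n ** s ** t)" using u(2)[of n] u(3)[OF s, of n] by simp
      moreover have "b n ** s ** t = (1 / norm (u n)) *\<^sub>R (u n ** s ** t)"
        by (simp add: b_def vec_eq_iff forall_2 mat22_mult_nth algebra_simps)
      ultimately show ?thesis using upos[of n] by (simp add: field_simps)
    qed
    then have "1 \<le> norm (b n ** s) * norm t" for n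
      using norm_mat_mult_le order_trans by blast
    moreover have "(\<lambda>n. b (r n) ** s) \<longlonglongrightarrow> B ** s"
      by (intro vec_tendstoI) (use lim in \<open>auto simp: mat22_mult_nth o_def intro!: tendsto_intros\<close>)
    then have "(\<lambda>n. norm (b (r n) ** s) * norm t) \<longlonglongrightarrow> norm (B ** s) * norm t"
      by (intro tendsto_intros)
    ultimately have "1 \<le> norm (B ** s) * norm t"
      by (intro LIMSEQ_le_const) auto
    then have "norm v \<le> norm (B ** s) * norm t * norm v"
      using mult_right_mono[of 1 "norm (B ** s) * norm t" "norm v"] by simp
    also have "\<dots> = norm (B ** s) * norm v * norm t" by simp
    also have "\<dots> = norm (adj2 s *v v) * norm t"
      using norm_mult_of_kernel[OF v(2), of s] \<open>norm B = 1\<close> by simp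
    finally show "norm v / norm t \<le> norm (adj2 s *v v)" using nt_pos by (simp add: field_simps)
  qed
  ultimately show thesis using that v(1) by blast
qed

end

section \<open>At most two missed horoballs at backward limit points\<close>

lemma inner_mat_vec_pos:
  assumes f: "f \<in> SL2" "norm f \<le> C" and ab: "\<bar>cross2 a b\<bar> * C ^ 4 < a \<bullet> b"
  shows "0 < (f *v a) \<bullet> (f *v b)"
proof -
  have C: "C > 0" using norm_SL2_pos[OF f(1)] f(2) by linarith
  have "0 \<le> \<bar>cross2 a b\<bar> * C ^ 4" using C by simp
  then have "0 < a \<bullet> b" using ab by linarith
  then have "a \<noteq> 0" by auto
  define a' :: "real^2" where "a' = vector [- a$2, a$1]"
  have a': "a'$1 = - a$2" "a'$2 = a$1" by (simp_all add: a'_def vector_2)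
  have "(norm a')\<^sup>2 = (norm a)\<^sup>2" by (simp add: norm_vec2 a')
  then have na': "norm a' = norm a" by simp
  have fn: "norm (f *v z) \<le> C * norm z" for z
    using norm_mat_vec_le[of f z] mult_right_mono[OF f(2), of "norm z"] by simp
  \<comment> \<open>This expands \<open>b\<close> in the orthogonal vectors \<open>a\<close> and
    \<open>a'\<close>. The main term is at least (a . b) |a|^2 / C^2 and the error at most |cross2 a
    b| C^2 |a|^2, whence the fourth power of \<open>C\<close>.\<close>
  have id: "((f *v a) \<bullet> (f *v b)) * (norm a)\<^sup>2
      = (a \<bullet> b) * (norm (f *v a))\<^sup>2 + cross2 a b * ((f *v a) \<bullet> (f *v a'))"
    unfolding norm_vec2 by (simp add: inner_vec2 mat22_vec_nth cross2_def a' power2_eq_square algebra_simps)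
  have "norm a \<le> C * norm (f *v a)"
    using norm_le_mult_SL2[OF f(1), of a] mult_right_mono[OF f(2), of "norm (f *v a)"] by simp
  then have lower: "(norm a)\<^sup>2 \<le> C\<^sup>2 * (norm (f *v a))\<^sup>2"
    using power_mono[of "norm a" "C * norm (f *v a)" 2] by (simp add: power_mult_distrib)
  have "\<bar>(f *v a) \<bullet> (f *v a')\<bar> \<le> (C * norm a) * (C * norm a')"
    using C by (intro order_trans[OF Cauchy_Schwarz_ineq2] mult_mono fn) auto
  then have "\<bar>cross2 a b * ((f *v a) \<bullet> (f *v a'))\<bar> \<le> \<bar>cross2 a b\<bar> * (C\<^sup>2 * (norm a)\<^sup>2)"
    unfolding abs_mult by (intro mult_left_mono) (auto simp: na' power2_eq_square algebra_simps)
  then have "C\<^sup>2 * \<bar>cross2 a b * ((f *v a) \<bullet> (f *v a'))\<bar> \<le> C\<^sup>2 * (\<bar>cross2 a b\<bar> * (C\<^sup>2 * (norm a)\<^sup>2))"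
    by (intro mult_left_mono) auto
  then have upper: "C\<^sup>2 * \<bar>cross2 a b * ((f *v a) \<bullet> (f *v a'))\<bar> \<le> (\<bar>cross2 a b\<bar> * C ^ 4) * (norm a)\<^sup>2"
    by (simp add: algebra_simps power2_eq_square power4_eq_xxxx)
  have "(\<bar>cross2 a b\<bar> * C ^ 4) * (norm a)\<^sup>2 < (a \<bullet> b) * (norm a)\<^sup>2"
    using ab \<open>a \<noteq> 0\<close> by (intro mult_strict_right_mono) auto
  also have "\<dots> \<le> (a \<bullet> b) * (C\<^sup>2 * (norm (f *v a))\<^sup>2)"
    using \<open>0 < a \<bullet> b\<close> by (intro mult_left_mono lower) auto
  finally have "C\<^sup>2 * \<bar>cross2 a b * ((f *v a) \<bullet> (f *v a'))\<bar> < C\<^sup>2 * ((a \<bullet> b) * (norm (f *v a))\<^sup>2)"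
    using upper by (simp add: algebra_simps)
  then have "\<bar>cross2 a b * ((f *v a) \<bullet> (f *v a'))\<bar> < (a \<bullet> b) * (norm (f *v a))\<^sup>2"
    using C by simp
  then have "0 < ((f *v a) \<bullet> (f *v b)) * (norm a)\<^sup>2" unfolding id by linarith
  then show ?thesis using \<open>a \<noteq> 0\<close> by (simp add: zero_less_mult_iff)
qed

text \<open>The sign of \<open>A\<^sup>-\<^sup>1 x \<bullet> A\<^sup>-\<^sup>1 y\<close> tells on which side of the geodesic from \<open>[x]\<close> to \<open>[y]\<close> the point
  \<open>A i\<close> lies. A point of that geodesic far from \<open>i\<close> is deep in a horoball at \<open>[x]\<close> or \<open>[y]\<close>, so the
  far-away orbit \<open>u M i\<close>, which moves in bounded steps, cannot cross it. It accumulates at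
  \<open>[x + y]\<close>, which determines the side.\<close>

lemma (in matrix_semigroup) inner_neg_if_escaping:
  assumes G: "finite G" "M = mat_products G"
    and xy: "cross2 x y \<noteq> 0" "horo_avoids M x" "horo_avoids M y"
    and acc: "\<And>u. u \<in> M \<Longrightarrow> approaches M (adj2 u *v (x + y))"
  shows "\<exists>R. \<forall>u\<in>M. R \<le> norm u \<and> (\<forall>s\<in>M. R \<le> norm (u ** s)) \<longrightarrow>
    (adj2 u *v x) \<bullet> (adj2 u *v y) < - \<bar>cross2 x y\<bar>"
proof -
  \<comment> \<open>The inserted 1 covers an empty \<open>G\<close> and makes \<open>D\<close> at
    most \<open>L\<close> below.\<close>
  define C where "C = Max (insert 1 (norm ` G))"
  have CG: "norm f \<le> C" if "f \<in> G" for f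
    using G(1) that by (simp add: C_def)
  have C1: "1 \<le> C" using G(1) by (simp add: C_def)
  obtain e1 e2 where e12: "e1 > 0" "\<And>A. A \<in> M \<Longrightarrow> e1 \<le> norm (adj2 A *v x)"
    "e2 > 0" "\<And>A. A \<in> M \<Longrightarrow> e2 \<le> norm (adj2 A *v y)"
    using xy unfolding horo_avoids_def by blast
  define e where "e = min e1 e2"
  have e: "e > 0" "\<And>A. A \<in> M \<Longrightarrow> e \<le> norm (adj2 A *v x)" "\<And>A. A \<in> M \<Longrightarrow> e \<le> norm (adj2 A *v y)"
    using e12 by (force simp: e_def)+
  define D where "D = \<bar>cross2 x y\<bar>"
  define K where "K = norm x + norm y"
  \<comment> \<open>\<open>L\<close> is the threshold of \<open>inner_mat_vec_pos\<close> for one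
    generator; \<open>R\<close> is chosen to give |a| |b| at least D + L in
    \<open>gap\<close>.\<close>
  define L where "L = D * C ^ 4"
  define R where "R = 2 * K * (D + L) / (e * D)"
  have D: "D > 0" using xy(1) by (simp add: D_def)
  have "x \<noteq> 0" using xy(1) by (auto simp: cross2_def)
  then have K: "K > 0" by (simp add: K_def add_pos_nonneg)
  have L: "D \<le> L" using C1 D by (simp add: L_def)
  have basis: "D * norm A \<le> (norm (adj2 A *v x) + norm (adj2 A *v y)) * K" for A
    using norm_mat_le_basis[of x y "adj2 A"] by (simp add: D_def K_def)
  \<comment> \<open>Far from i the sum |a| + |b| is large, and the missed horoballs keep both terms
    at least \<open>e\<close>, so the product is large. As the cross product is fixed, Lagrange's
    identity makes the inner product large.\<close>
  have gap: "L < \<bar>(adj2 A *v x) \<bullet> (adj2 A *v y)\<bar>" if A: "A \<in> M" "R \<le> norm A" for A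
  proof -
    define a b where "a = adj2 A *v x" and "b = adj2 A *v y"
    have ab: "e \<le> norm a" "e \<le> norm b" using e A by (simp_all add: a_def b_def)
    have "D * R \<le> (norm a + norm b) * K"
      using basis[of A] A(2) D by (smt (verit) a_def b_def mult_left_mono)
    then have "2 * (D + L) * K \<le> e * (norm a + norm b) * K"
    proof -
      have "D * R = 2 * (D + L) * K / e" using D by (simp add: R_def)
      then show ?thesis using \<open>D * R \<le> (norm a + norm b) * K\<close> e(1)
        by (simp add: pos_divide_le_eq algebra_simps)
    qed
    then have "2 * (D + L) \<le> e * (norm a + norm b)" using K by simp
    moreover have "0 \<le> (norm a - e) * norm b + (norm b - e) * norm a" using ab by simp
    ultimately have "D + L \<le> norm a * norm b" by (simp add: algebra_simps)
    then have "(D + L)\<^sup>2 \<le> (norm a)\<^sup>2 * (norm b)\<^sup>2"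
      using power_mono[of "D + L" "norm a * norm b" 2] D L by (simp add: power_mult_distrib)
    also have "\<dots> = (a \<bullet> b)\<^sup>2 + D\<^sup>2"
      unfolding cross2_inner[symmetric] using cross2_adj2[OF in_SL2[OF A(1)]]
      by (simp add: a_def b_def D_def)
    finally have "L\<^sup>2 + 2 * (D * L) \<le> (a \<bullet> b)\<^sup>2" by (simp add: power2_sum)
    moreover have "0 < D * L" using D L by simp
    ultimately have "L\<^sup>2 < (a \<bullet> b)\<^sup>2" by linarith
    then show ?thesis using abs_le_square_iff[of "a \<bullet> b" L] D L by (simp add: a_def b_def)
  qed
  show ?thesis
  proof (intro exI ballI impI; elim conjE; rule ccontr)
    fix u assume u: "u \<in> M" "R \<le> norm u" and us: "\<forall>s\<in>M. R \<le> norm (u ** s)"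
      and neg: "\<not> (adj2 u *v x) \<bullet> (adj2 u *v y) < - \<bar>cross2 x y\<bar>"
    define U where "U = insert u ((**) u ` M)"
    have U: "A \<in> M" "R \<le> norm A" if "A \<in> U" for A
      using that u us mult_closed by (auto simp: U_def)
    have US: "A ** s \<in> U" if "A \<in> U" "s \<in> M" for A s
      using that mult_closed by (auto simp: U_def simp flip: matrix_mul_assoc)
    \<comment> \<open>One generator cannot change the sign, by \<open>inner_mat_vec_pos\<close>, and
      \<open>gap\<close> restores the threshold \<open>L\<close>. \<open>A\<close> is kept arbitrary
      because products extend to the right.\<close>
    have step: "L < (adj2 (A ** s) *v x) \<bullet> (adj2 (A ** s) *v y)"
      if "s \<in> mat_products G" "A \<in> U" "L < (adj2 A *v x) \<bullet> (adj2 A *v y)" for A s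
      using that
    proof (induction arbitrary: A)
      case (base f)
      then have f: "f \<in> M" using G(2) mat_products.base by blast
      have "\<bar>cross2 (adj2 A *v x) (adj2 A *v y)\<bar> * C ^ 4 < (adj2 A *v x) \<bullet> (adj2 A *v y)"
        using base cross2_adj2[OF in_SL2[OF U(1)[OF base(2)]]] by (simp add: L_def D_def)
      then have "0 < (adj2 f *v (adj2 A *v x)) \<bullet> (adj2 f *v (adj2 A *v y))"
        using in_SL2[OF f] CG[OF base(1)] by (intro inner_mat_vec_pos) (auto simp: adj2_SL2)
      moreover have "L < \<bar>(adj2 (A ** f) *v x) \<bullet> (adj2 (A ** f) *v y)\<bar>"
        using US[OF base(2) f] U by (intro gap)
      ultimately show ?case by (simp add: adj2_mult_vec)
    next
      case (mult s1 s2)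
      then have "A ** s1 \<in> U" using US G(2) by blast
      then show ?case using mult by (simp add: matrix_mul_assoc)
    qed
    \<comment> \<open>By \<open>gap\<close> the value is above \<open>L\<close> or below -L; the
      latter is excluded by \<open>neg\<close>, as \<open>D\<close> is at most
      \<open>L\<close>.\<close>
    have u0: "L < (adj2 u *v x) \<bullet> (adj2 u *v y)"
      using gap[OF u] neg L by (simp add: D_def)
    have upos: "norm u > 0" using norm_SL2_pos in_SL2 u(1) by blast
    \<comment> \<open>Chosen so that |a + b| < (|a| + |b|) / 2 below, which is incompatible with a .
      b > 0.\<close>
    define q where "q = D / (2 * K * norm u)"
    have "q > 0" using D K upos by (simp add: q_def)
    then obtain s where s: "s \<in> M" "norm (adj2 s *v (adj2 u *v (x + y))) < q * norm s"
      using acc[OF u(1)] unfolding approaches_def by blast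
    define a b where "a = adj2 (u ** s) *v x" and "b = adj2 (u ** s) *v y"
    have "s = adj2 u ** (u ** s)"
      using adj2_left[OF in_SL2[OF u(1)]] by (simp add: matrix_mul_assoc)
    then have "norm s \<le> norm u * norm (u ** s)"
      using norm_mat_mult_le[of "adj2 u" "u ** s"] by simp
    then have "q * norm s \<le> q * (norm u * norm (u ** s))"
      using \<open>q > 0\<close> by (intro mult_left_mono) auto
    also have "\<dots> = D * norm (u ** s) / (2 * K)"
      using upos by (simp add: q_def)
    also have "\<dots> \<le> (norm a + norm b) / 2"
      using basis[of "u ** s"] K by (simp add: a_def b_def field_simps)
    finally have "norm (a + b) < (norm a + norm b) / 2"
      using s(2) by (simp add: a_def b_def adj2_mult_vec matrix_vector_right_distrib)
    then have "(norm (a + b))\<^sup>2 < ((norm a + norm b) / 2)\<^sup>2"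
      by (intro power_strict_mono) auto
    moreover have "(norm (a + b))\<^sup>2 = (norm a)\<^sup>2 + (norm b)\<^sup>2 + 2 * (a \<bullet> b)"
      by (simp add: power2_norm_eq_inner inner_add inner_commute)
    moreover have "a \<bullet> b > 0"
      using step[OF _ _ u0, of s] s(1) G(2) D L by (simp add: U_def a_def b_def)
    moreover have "((norm a + norm b) / 2)\<^sup>2 \<le> (norm a)\<^sup>2 + (norm b)\<^sup>2"
      using sum_squares_bound[of "norm a" "norm b"]
      by (simp add: power_divide power2_sum) (smt (verit) zero_le_power2)
    ultimately show False by linarith
  qed
qed

text \<open>An escaping u i would lie in the ideal triangle with the three vertices. Since |a . b| /
  D is sinh of the distance to a side, it would be farther than arsinh 1 from every side, but the
  inradius is only (ln 3) / 2.\<close>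

lemma (in noninvertible_matrix_semigroup) no_three_horo_avoiding:
  assumes G: "finite G" "M = mat_products G"
    and incl: "\<And>v. approaches (adj2 ` M) v \<Longrightarrow> approaches M v"
    and h: "horo_avoids M x" "horo_avoids M y" "horo_avoids M z"
    and a: "approaches (adj2 ` M) x" "approaches (adj2 ` M) y" "approaches (adj2 ` M) z"
    and c: "cross2 x y \<noteq> 0" "cross2 y z \<noteq> 0" "cross2 z x \<noteq> 0"
  shows False
proof -
  \<comment> \<open>rescaled so that the three vectors add up to zero and have equal cross products\<close>
  define x' y' z' where "x' = cross2 y z *\<^sub>R x" and "y' = cross2 z x *\<^sub>R y" and "z' = cross2 x y *\<^sub>R z"
  have sum0: "x' + y' = - z'" "y' + z' = - x'" "z' + x' = - y'"
    by (simp_all add: vec_eq_iff forall_2 x'_def y'_def z'_def cross2_def algebra_simps)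
  have h': "horo_avoids M x'" "horo_avoids M y'" "horo_avoids M z'"
    using h c horo_avoids_scaleR by (simp_all add: x'_def y'_def z'_def)
  have c': "cross2 x' y' \<noteq> 0" "cross2 y' z' \<noteq> 0" "cross2 z' x' \<noteq> 0"
    using c by (simp_all add: x'_def y'_def z'_def cross2_def flip: right_diff_distrib)
  \<comment> \<open>The inclusion of limit sets enters here: moving a backward limit point by u^-1
    leaves it one, hence also a forward one.\<close>
  have a': "approaches M (adj2 u *v (- w))" if "approaches (adj2 ` M) v" "w = k *\<^sub>R v" "u \<in> M" for u v w k
  proof -
    have "adj2 u *v (- w) = (- k) *\<^sub>R (adj2 u *v v)"
      by (simp add: that(2) flip: matrix_vector_mult_scaleR)
    then show ?thesis
      using approaches_scaleR[OF incl[OF approaches_adj2_image_adj2[OF that(1,3)]], of "- k"] by simp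
  qed
  obtain R1 where R1: "\<forall>u\<in>M. R1 \<le> norm u \<and> (\<forall>s\<in>M. R1 \<le> norm (u ** s)) \<longrightarrow>
    (adj2 u *v x') \<bullet> (adj2 u *v y') < - \<bar>cross2 x' y'\<bar>"
  proof -
    have "approaches M (adj2 u *v (x' + y'))" if "u \<in> M" for u
      unfolding sum0 by (rule a'[OF a(3) z'_def that])
    from inner_neg_if_escaping[OF G c'(1) h'(1,2) this] show thesis using that by blast
  qed
  obtain R2 where R2: "\<forall>u\<in>M. R2 \<le> norm u \<and> (\<forall>s\<in>M. R2 \<le> norm (u ** s)) \<longrightarrow>
    (adj2 u *v y') \<bullet> (adj2 u *v z') < - \<bar>cross2 y' z'\<bar>"
  proof -
    have "approaches M (adj2 u *v (y' + z'))" if "u \<in> M" for u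
      unfolding sum0 by (rule a'[OF a(1) x'_def that])
    from inner_neg_if_escaping[OF G c'(2) h'(2,3) this] show thesis using that by blast
  qed
  obtain R3 where R3: "\<forall>u\<in>M. R3 \<le> norm u \<and> (\<forall>s\<in>M. R3 \<le> norm (u ** s)) \<longrightarrow>
    (adj2 u *v z') \<bullet> (adj2 u *v x') < - \<bar>cross2 z' x'\<bar>"
  proof -
    have "approaches M (adj2 u *v (z' + x'))" if "u \<in> M" for u
      unfolding sum0 by (rule a'[OF a(2) y'_def that])
    from inner_neg_if_escaping[OF G c'(3) h'(3,1) this] show thesis using that by blast
  qed
  obtain u where u: "u \<in> M" "Max {R1, R2, R3} \<le> norm u" "\<And>s. s \<in> M \<Longrightarrow> Max {R1, R2, R3} \<le> norm (u ** s)"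
    using escaping_element'[of "Max {R1, R2, R3}"] by blast
  define a b c where "a = adj2 u *v x'" and "b = adj2 u *v y'" and "c = adj2 u *v z'"
  have abc: "c = - (a + b)"
  proof -
    have "a + b = adj2 u *v (- z')"
      by (simp add: a_def b_def flip: sum0(1) matrix_vector_right_distrib)
    also have "\<dots> = - c" by (simp add: c_def vec_eq_iff mat22_vec_nth)
    finally show ?thesis by simp
  qed
  define D where "D = \<bar>cross2 x' y'\<bar>"
  have D: "\<bar>cross2 y' z'\<bar> = D" "\<bar>cross2 z' x'\<bar> = D"
    by (simp_all add: D_def x'_def y'_def z'_def cross2_def algebra_simps)
  have "D > 0" using c'(1) by (simp add: D_def)
  have neg: "D < - (a \<bullet> b)" "D < - (b \<bullet> c)" "D < - (c \<bullet> a)"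
    using R1[rule_format, OF u(1)] R2[rule_format, OF u(1)] R3[rule_format, OF u(1)] u(2,3)
    unfolding D D_def[symmetric] a_def b_def c_def by force+
  \<comment> \<open>Algebraic form of the inradius bound: the three products add up to D^2, although
    the first alone exceeds it and the others are positive.\<close>
  have "D * D < (a \<bullet> b) * (b \<bullet> c)" "0 < (b \<bullet> c) * (c \<bullet> a)" "0 < (c \<bullet> a) * (a \<bullet> b)"
    using mult_strict_mono[OF neg(1,2)] neg \<open>D > 0\<close> by (auto intro: mult_neg_neg)
  moreover have "(a \<bullet> b) * (b \<bullet> c) + (b \<bullet> c) * (c \<bullet> a) + (c \<bullet> a) * (a \<bullet> b) = (cross2 a b)\<^sup>2"
    by (simp add: abc inner_vec2 cross2_def power2_eq_square algebra_simps)
  moreover have "(cross2 a b)\<^sup>2 = D * D"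
    using cross2_adj2[OF in_SL2[OF u(1)]] by (simp add: a_def b_def D_def power2_eq_square)
  ultimately show False by linarith
qed

section \<open>Excluding one or two missed horoballs\<close>

lemma (in matrix_semigroup) eigenvalue_ge_1_if_horo_avoids:
  assumes v: "horo_avoids M v" and s: "s \<in> M" "adj2 s *v v = k *\<^sub>R v"
  shows "1 \<le> \<bar>k\<bar>"
proof (rule ccontr)
  assume "\<not> 1 \<le> \<bar>k\<bar>"
  obtain e where e: "e > 0" "\<And>A. A \<in> M \<Longrightarrow> e \<le> norm (adj2 A *v v)"
    using v unfolding horo_avoids_def by blast
  \<comment> \<open>Powers of \<open>s\<close> would shrink \<open>v\<close> to 0. The exponents
    start at 1 because \<open>M\<close> need not contain the identity.\<close>
  have "\<exists>A\<in>M. adj2 A *v v = (k ^ Suc n) *\<^sub>R v" for n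
  proof (induction n)
    case 0 then show ?case using s by auto
  next
    case (Suc n)
    then obtain A where A: "A \<in> M" "adj2 A *v v = (k ^ Suc n) *\<^sub>R v" by blast
    then have "adj2 (A ** s) *v v = (k ^ Suc (Suc n)) *\<^sub>R v"
      using s by (simp add: adj2_mult_vec matrix_vector_mult_scaleR)
    then show ?case using A s mult_closed by blast
  qed
  then have "e \<le> \<bar>k\<bar> ^ Suc n * norm v" for n
    using e(2) by (metis norm_scaleR power_abs)
  moreover have "(\<lambda>n. \<bar>k\<bar> ^ Suc n * norm v) \<longlonglongrightarrow> 0 * norm v"
    using \<open>\<not> 1 \<le> \<bar>k\<bar>\<close> by (intro tendsto_intros LIMSEQ_Suc LIMSEQ_power_zero) auto
  ultimately have "e \<le> 0 * norm v" by (intro LIMSEQ_le_const) auto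
  then show False using e by simp
qed

text \<open>By \<open>norm_le_mult_SL2\<close>, |s v| / |s| is at least |v| / |s|^2, hence at least
  |v| / B^2.\<close>

lemma (in matrix_semigroup) norm_bound_not_approaches:
  assumes "v \<noteq> 0" "\<And>s. s \<in> M \<Longrightarrow> norm s \<le> B"
  shows "\<not> approaches (adj2 ` M) v"
proof
  assume app: "approaches (adj2 ` M) v"
  have "M \<noteq> {}" using app unfolding approaches_adj2_image by (meson ex_in_conv zero_less_one)
  then obtain s0 where "s0 \<in> M" by blast
  then have B: "B > 0" using norm_SL2_pos[OF in_SL2] assms(2) by (meson less_le_trans)
  then have "norm v / B\<^sup>2 > 0" using assms(1) by simp
  then obtain s where s: "s \<in> M" "norm (s *v v) < norm v / B\<^sup>2 * norm s"
    using app unfolding approaches_adj2_image by blast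
  have spos: "norm s > 0" using norm_SL2_pos in_SL2 s(1) by blast
  have "norm v \<le> norm s * norm (s *v v)" using norm_le_mult_SL2 in_SL2 s(1) by blast
  also have "\<dots> < norm s * (norm v / B\<^sup>2 * norm s)" using s spos by (intro mult_strict_left_mono)
  also have "\<dots> = norm v / B\<^sup>2 * (norm s * norm s)" by simp
  also have "\<dots> \<le> norm v / B\<^sup>2 * (B * B)"
    using assms(2)[OF s(1)] B by (intro mult_left_mono mult_mono) auto
  also have "\<dots> = norm v" using B by (simp add: power2_eq_square)
  finally show False by simp
qed

text \<open>Elements of \<open>M\<close> do not lengthen \<open>v\<close>. One that makes |s y|
  small relative to |s| therefore has bounded norm, and then |s v| |s y| is too small for the
  invariant cross product.\<close>

lemma (in matrix_semigroup) common_eigenvector_contradiction: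
  assumes v: "v \<noteq> 0" "horo_avoids M v" and fix_v: "\<And>s. s \<in> M \<Longrightarrow> cross2 v (adj2 s *v v) = 0"
    and y: "approaches (adj2 ` M) y" "cross2 v y \<noteq> 0"
  shows False
proof -
  have sv: "norm (s *v v) \<le> norm v" if s: "s \<in> M" for s
  proof -
    obtain k where k: "adj2 s *v v = k *\<^sub>R v"
      using cross2_eq_0_imp_scaleR[OF fix_v[OF s] v(1)] by blast
    then have "1 \<le> \<bar>k\<bar>" using eigenvalue_ge_1_if_horo_avoids v s by blast
    have "v = s *v (adj2 s *v v)"
      using adj2_right[OF in_SL2[OF s]] by (simp add: matrix_vector_mul_assoc)
    then have "v = k *\<^sub>R (s *v v)" by (simp add: k matrix_vector_mult_scaleR)
    then have "norm v = \<bar>k\<bar> * norm (s *v v)" by (metis norm_scaleR)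
    then show ?thesis using mult_right_mono[OF \<open>1 \<le> \<bar>k\<bar>\<close>, of "norm (s *v v)"] by simp
  qed
  define D where "D = \<bar>cross2 v y\<bar>"
  define K where "K = norm v + norm y"
  have D: "D > 0" using y by (simp add: D_def)
  have K: "K > 0" using v by (simp add: K_def add_pos_nonneg)
  \<comment> \<open>The first bound absorbs the |s y| term when |s| is estimated; the second makes
    |s v| |s y| less than \<open>D\<close>.\<close>
  define e where "e = min (D / (2 * K)) (D\<^sup>2 / (2 * (norm v)\<^sup>2 * K))"
  have e: "e > 0" "e \<le> D / (2 * K)" "e \<le> D\<^sup>2 / (2 * (norm v)\<^sup>2 * K)"
    using D K v(1) by (auto simp: e_def)
  then obtain s where s: "s \<in> M" "norm (s *v y) < e * norm s"
    using y(1) unfolding approaches_adj2_image by blast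
  have spos: "norm s > 0" using norm_SL2_pos in_SL2 s(1) by blast
  have "D * norm s \<le> (norm (s *v v) + norm (s *v y)) * K"
    using norm_mat_le_basis[of v y s] by (simp add: D_def K_def)
  also have "\<dots> \<le> (norm v + D / (2 * K) * norm s) * K"
  proof (intro mult_right_mono add_mono sv s(1))
    show "norm (s *v y) \<le> D / (2 * K) * norm s"
      using s(2) mult_right_mono[OF e(2), of "norm s"] by simp
  qed (use K in auto)
  also have "\<dots> = norm v * K + D * norm s / 2" using K by (simp add: field_simps)
  finally have sn: "D * norm s \<le> 2 * norm v * K" by simp
  have "D = \<bar>cross2 (s *v v) (s *v y)\<bar>"
    using in_SL2[OF s(1)] by (simp add: D_def cross2_mat_vec SL2_def)
  also have "\<dots> \<le> norm (s *v v) * norm (s *v y)" by (rule abs_cross2_le)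
  also have "\<dots> \<le> norm v * norm (s *v y)" using sv[OF s(1)] by (intro mult_right_mono) auto
  also have "\<dots> < norm v * (e * norm s)" using s(2) v(1) by simp
  also have "\<dots> \<le> norm v * (D\<^sup>2 / (2 * (norm v)\<^sup>2 * K) * norm s)"
    using e(3) by (intro mult_left_mono mult_right_mono) auto
  also have "\<dots> = D * (D * norm s) / (2 * norm v * K)"
    using v(1) K by (simp add: power2_eq_square)
  also have "\<dots> \<le> D * (2 * norm v * K) / (2 * norm v * K)"
    using sn D K by (intro divide_right_mono mult_left_mono) auto
  also have "\<dots> = D" using v(1) K by simp
  finally show False by simp
qed

text \<open>Being injective, \<open>s\<close> fixes or swaps the two lines; as det s = 1, the
  product of the two scaling factors is 1 or -1.\<close>

lemma norm_mult_eq_if_pair_preserved: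
  assumes s: "s \<in> SL2" and vw: "v \<noteq> 0" "w \<noteq> 0" "cross2 v w \<noteq> 0"
    and pv: "cross2 v (s *v v) = 0 \<or> cross2 w (s *v v) = 0"
    and pw: "cross2 v (s *v w) = 0 \<or> cross2 w (s *v w) = 0"
  shows "norm (s *v v) * norm (s *v w) = norm v * norm w"
proof -
  have cr: "cross2 (s *v v) (s *v w) = cross2 v w"
    using s by (simp add: cross2_mat_vec SL2_def)
  consider k where "s *v v = k *\<^sub>R v" | k where "s *v v = k *\<^sub>R w"
    using pv cross2_eq_0_imp_scaleR vw by metis
  then show ?thesis
  proof cases
    case (1 k)
    consider m where "s *v w = m *\<^sub>R v" | m where "s *v w = m *\<^sub>R w"
      using pw cross2_eq_0_imp_scaleR vw by metis
    then show ?thesis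
    proof cases
      case (1 m)
      then have "cross2 (s *v v) (s *v w) = 0" using \<open>s *v v = k *\<^sub>R v\<close> by (simp add: cross2_def)
      then show ?thesis using cr vw by simp
    next
      case (2 m)
      then have "(k * m) * cross2 v w = cross2 v w"
        using cr \<open>s *v v = k *\<^sub>R v\<close> by (simp add: cross2_def algebra_simps)
      then have "\<bar>k\<bar> * \<bar>m\<bar> = 1" using vw by (simp flip: abs_mult)
      then have "\<bar>k\<bar> * norm v * (\<bar>m\<bar> * norm w) = norm v * norm w" by algebra
      then show ?thesis using \<open>s *v v = k *\<^sub>R v\<close> 2 by simp
    qed
  next
    case (2 k)
    consider m where "s *v w = m *\<^sub>R v" | m where "s *v w = m *\<^sub>R w"
      using pw cross2_eq_0_imp_scaleR vw by metis
    then show ?thesis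
    proof cases
      case (1 m)
      then have "(- (k * m)) * cross2 v w = cross2 v w"
        using cr \<open>s *v v = k *\<^sub>R w\<close> by (simp add: cross2_def algebra_simps)
      then have "- (k * m) = 1" using vw(3) by (metis mult_cancel_right1)
      then have "\<bar>k\<bar> * \<bar>m\<bar> = 1" by (metis abs_minus_cancel abs_mult abs_one)
      then have "\<bar>k\<bar> * norm w * (\<bar>m\<bar> * norm v) = norm v * norm w" by algebra
      then show ?thesis using \<open>s *v v = k *\<^sub>R w\<close> 1 by simp
    next
      case (2 m)
      then have "cross2 (s *v v) (s *v w) = 0" using \<open>s *v v = k *\<^sub>R w\<close> by (simp add: cross2_def)
      then show ?thesis using cr vw by simp
    qed
  qed
qed

lemma (in noninvertible_matrix_semigroup) no_inclusion_of_limit_sets: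
  assumes G: "finite G" "M = mat_products G"
    and incl: "\<And>v. approaches (adj2 ` M) v \<Longrightarrow> approaches M v"
    and two: "\<And>v. v \<noteq> 0 \<Longrightarrow> approaches (adj2 ` M) v \<Longrightarrow>
      \<exists>y. approaches (adj2 ` M) y \<and> cross2 v y \<noteq> 0"
  shows False
proof -
  obtain v where v: "v \<noteq> 0" "approaches (adj2 ` M) v" "horo_avoids M v"
    using exists_horo_avoids by blast
  show False
  proof (cases "\<forall>s\<in>M. cross2 v (adj2 s *v v) = 0")
    case True
    then show False using common_eigenvector_contradiction[OF v(1,3)] two[OF v(1,2)] by blast
  next
    case False
    then obtain g where g: "g \<in> M" "cross2 v (adj2 g *v v) \<noteq> 0" by blast
    define w where "w = adj2 g *v v"
    have w: "w \<noteq> 0" "approaches (adj2 ` M) w" "horo_avoids M w"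
      using approaches_adj2_image_adj2 horo_avoids_adj2 v g(1) mat_vec_nonzero_SL2[of "adj2 g"] in_SL2
      by (simp_all add: w_def adj2_SL2)
    have vw: "cross2 v w \<noteq> 0" using g by (simp add: w_def)
    \<comment> \<open>Otherwise the image would be a third missed direction, besides
      \<open>v\<close> and \<open>w\<close>.\<close>
    have pair: "cross2 v (adj2 s *v z) = 0 \<or> cross2 w (adj2 s *v z) = 0"
      if "s \<in> M" "z = v \<or> z = w" for s z
    proof (rule ccontr)
      assume *: "\<not> ?thesis"
      have a: "approaches (adj2 ` M) (adj2 s *v z)" "horo_avoids M (adj2 s *v z)"
        using approaches_adj2_image_adj2 horo_avoids_adj2 v w that by auto
      have "cross2 (adj2 s *v z) v = - cross2 v (adj2 s *v z)" by (simp add: cross2_def)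
      with * have "cross2 w (adj2 s *v z) \<noteq> 0" "cross2 (adj2 s *v z) v \<noteq> 0" by simp_all
      with no_three_horo_avoiding[OF G incl v(3) w(3) a(2) v(2) w(2) a(1) vw] show False by simp
    qed
    obtain e1 e2 where e12: "e1 > 0" "\<And>A. A \<in> M \<Longrightarrow> e1 \<le> norm (adj2 A *v v)"
      "e2 > 0" "\<And>A. A \<in> M \<Longrightarrow> e2 \<le> norm (adj2 A *v w)"
      using v(3) w(3) unfolding horo_avoids_def by blast
    define D where "D = \<bar>cross2 v w\<bar>"
    define P where "P = norm v * norm w"
    have D: "D > 0" using vw by (simp add: D_def)
    \<comment> \<open>The product of the two lengths is constant and each is bounded below, so each
      is bounded above, and so is |s|.\<close>
    have "norm s \<le> (P / e2 + P / e1) * (norm v + norm w) / D" if s: "s \<in> M" for s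
    proof -
      have prod: "norm (adj2 s *v v) * norm (adj2 s *v w) = P"
        unfolding P_def using in_SL2[OF s] v(1) w(1) vw pair[OF s]
        by (intro norm_mult_eq_if_pair_preserved) (auto simp: adj2_SL2)
      have "norm (adj2 s *v v) \<le> P / e2"
        using mult_left_mono[OF e12(4)[OF s], of "norm (adj2 s *v v)"] prod e12(3)
        by (simp add: pos_le_divide_eq)
      moreover have "norm (adj2 s *v w) \<le> P / e1"
        using mult_right_mono[OF e12(2)[OF s], of "norm (adj2 s *v w)"] prod e12(1)
        by (simp add: pos_le_divide_eq mult.commute)
      ultimately have "(norm (adj2 s *v v) + norm (adj2 s *v w)) * (norm v + norm w)
          \<le> (P / e2 + P / e1) * (norm v + norm w)"
        by (intro mult_right_mono add_mono) auto
      then have "D * norm s \<le> (P / e2 + P / e1) * (norm v + norm w)"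
        using norm_mat_le_basis[of v w "adj2 s"] by (simp add: D_def)
      then show ?thesis using D by (simp add: pos_le_divide_eq mult.commute)
    qed
    then show False using norm_bound_not_approaches[OF v(1)] v(2) by blast
  qed
qed

section \<open>Moebius transformations and limit sets\<close>

text \<open>Homogeneous coordinates on the boundary. The zero vector also goes to
  \<open>Infty\<close>, so it has to be excluded where points matter.\<close>

definition boundary_point :: "real^2 \<Rightarrow> csphere" where
  "boundary_point v = (if v$2 = 0 then Infty else Fin (of_real (v$1 / v$2)))"

lemma ideal_boundary_eq: "ideal_boundary = boundary_point ` (- {0})"
proof
  show "ideal_boundary \<subseteq> boundary_point ` (- {0})"
  proof
    fix p assume "p \<in> ideal_boundary"
    then consider "p = Infty" | x where "p = Fin (of_real x)"
      by (auto simp: ideal_boundary_def)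
    then show "p \<in> boundary_point ` (- {0})"
    proof cases
      case 1
      then show ?thesis
        by (intro image_eqI[of _ _ "vector [1, 0]"])
          (auto simp: boundary_point_def vec_eq_iff forall_2 vector_2)
    next
      case 2
      then show ?thesis
        by (intro image_eqI[of _ _ "vector [x, 1]"])
          (auto simp: boundary_point_def vec_eq_iff forall_2 vector_2)
    qed
  qed
  show "boundary_point ` (- {0}) \<subseteq> ideal_boundary"
    by (auto simp: boundary_point_def ideal_boundary_def simp flip: of_real_divide)
qed

lemma boundary_point_eq_iff:
  assumes "v \<noteq> 0" "w \<noteq> 0"
  shows "boundary_point v = boundary_point w \<longleftrightarrow> cross2 v w = 0"
proof
  assume "cross2 v w = 0"
  then obtain k where k: "w = k *\<^sub>R v" using cross2_eq_0_imp_scaleR assms by metis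
  then have "k \<noteq> 0" using assms by auto
  then show "boundary_point v = boundary_point w" by (simp add: boundary_point_def k)
next
  assume eq: "boundary_point v = boundary_point w"
  show "cross2 v w = 0"
  proof (cases "v$2 = 0 \<or> w$2 = 0")
    case True
    then show ?thesis using eq by (auto simp: boundary_point_def cross2_def split: if_splits)
  next
    case False
    then have "complex_of_real (v$1 / v$2) = complex_of_real (w$1 / w$2)"
      using eq by (simp add: boundary_point_def)
    then have "v$1 / v$2 = w$1 / w$2" by (simp only: of_real_eq_iff)
    then show ?thesis using False by (simp add: cross2_def field_simps)
  qed
qed

text \<open>Writing A i = num / den, one has |A|^2 = |num|^2 + |den|^2, and |A^-1 v| is the modulus
  of v2 num - v1 den.\<close>

lemma dist_boundary_point:
  assumes A: "A \<in> SL2" and v: "v \<noteq> 0"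
  shows "dist (real_moebius A (Fin \<i>)) (boundary_point v) = 2 * norm (adj2 A *v v) / (norm A * norm v)"
proof -
  define a b c d where "a = A $ 1 $ 1" and "b = A $ 1 $ 2" and "c = A $ 2 $ 1" and "d = A $ 2 $ 2"
  note defs = a_def b_def c_def d_def
  define num den where "num = of_real a * \<i> + of_real b" and "den = of_real c * \<i> + of_real d"
  have "a * d - b * c = 1" using A by (simp add: SL2_def det_2 defs)
  then have "den \<noteq> 0" by (auto simp: den_def complex_eq_iff)
  then have dpos: "cmod den > 0" by simp
  have val: "real_moebius A (Fin \<i>) = Fin (num / den)"
    using \<open>den \<noteq> 0\<close> by (simp add: real_moebius_def num_def den_def defs)
  have "(norm A)\<^sup>2 = (cmod num)\<^sup>2 + (cmod den)\<^sup>2"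
    by (simp add: norm_mat22 cmod_power2 num_def den_def defs)
  then have "1 + (cmod (num / den))\<^sup>2 = (norm A / cmod den)\<^sup>2"
    using dpos by (simp add: norm_divide power_divide field_simps)
  then have s: "sqrt (1 + (cmod (num / den))\<^sup>2) = norm A / cmod den" by simp
  show ?thesis
  proof (cases "v$2 = 0")
    case True
    then have "v$1 \<noteq> 0" using v by (auto simp: vec_eq_iff forall_2)
    have "(norm (adj2 A *v v))\<^sup>2 = (\<bar>v$1\<bar> * cmod den)\<^sup>2"
      unfolding norm_vec2 power_mult_distrib cmod_power2
      by (simp add: mat22_vec_nth True den_def defs power_mult_distrib algebra_simps)
    then have n: "norm (adj2 A *v v) = \<bar>v$1\<bar> * cmod den" by simp
    have nv: "norm v = \<bar>v$1\<bar>"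
      by (rule power2_eq_imp_eq) (simp_all add: norm_vec2 True)
    have "dist (real_moebius A (Fin \<i>)) (boundary_point v) = 2 / (norm A / cmod den)"
      by (simp only: val boundary_point_def True simp_thms if_True dist_csphere_def chordal.simps s)
    then show ?thesis using \<open>v$1 \<noteq> 0\<close> by (simp add: n nv)
  next
    case False
    define r where "r = v$1 / v$2"
    have "(norm v)\<^sup>2 = (1 + r\<^sup>2) * \<bar>v$2\<bar>\<^sup>2"
      using False by (simp add: norm_vec2 r_def power_divide field_simps)
    then have "1 + (cmod (of_real r))\<^sup>2 = (norm v / \<bar>v$2\<bar>)\<^sup>2"
      using False by (simp add: power_divide)
    then have s2: "sqrt (1 + (cmod (of_real r))\<^sup>2) = norm v / \<bar>v$2\<bar>" by simp
    have "(norm (adj2 A *v v))\<^sup>2 = (cmod (of_real (v$2) * num - of_real (v$1) * den))\<^sup>2"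
      unfolding norm_vec2 cmod_power2
      by (simp add: mat22_vec_nth num_def den_def defs power2_eq_square algebra_simps)
    then have n: "norm (adj2 A *v v) = cmod (of_real (v$2) * num - of_real (v$1) * den)" by simp
    have "num / den - of_real r = (of_real (v$2) * num - of_real (v$1) * den) / (of_real (v$2) * den)"
      using \<open>den \<noteq> 0\<close> False by (simp add: r_def field_simps)
    then have n2: "cmod (num / den - of_real r) = norm (adj2 A *v v) / (\<bar>v$2\<bar> * cmod den)"
      by (simp add: n norm_divide norm_mult)
    have "dist (real_moebius A (Fin \<i>)) (boundary_point v)
        = 2 * (norm (adj2 A *v v) / (\<bar>v$2\<bar> * cmod den)) / (norm A / cmod den * (norm v / \<bar>v$2\<bar>))"
      by (simp only: val boundary_point_def False if_False dist_csphere_def chordal.simps s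
          r_def[symmetric] s2 n2)
    then show ?thesis using False dpos by simp
  qed
qed

lemma forward_limit_set_eq:
  assumes N: "N \<subseteq> SL2"
  shows "forward_limit_set (real_moebius ` N) = boundary_point ` {v. v \<noteq> 0 \<and> approaches N v}"
proof -
  have "boundary_point v islimpt (\<lambda>g. g (Fin \<i>)) ` real_moebius ` N \<longleftrightarrow> approaches N v"
    if v: "v \<noteq> 0" for v
  proof -
    have pos: "norm A > 0" "norm v > 0" "norm (adj2 A *v v) > 0" if "A \<in> N" for A
      using that N v norm_SL2_pos[of A] mat_vec_nonzero_SL2[of "adj2 A"] by (auto simp: adj2_SL2)
    \<comment> \<open>The orbit never hits the boundary, so accumulating at a boundary point is the
      same as coming arbitrarily close to it.\<close>
    have ne: "real_moebius A (Fin \<i>) \<noteq> boundary_point v" if "A \<in> N" for A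
      using dist_boundary_point[of A v] pos[OF that] that N v by fastforce
    have "boundary_point v islimpt (\<lambda>g. g (Fin \<i>)) ` real_moebius ` N \<longleftrightarrow>
        (\<forall>e>0. \<exists>A\<in>N. dist (real_moebius A (Fin \<i>)) (boundary_point v) < e)"
      unfolding islimpt_approachable using ne by auto
    also have "\<dots> \<longleftrightarrow> (\<forall>e>0. \<exists>A\<in>N. norm (adj2 A *v v) < e * (norm v / 2) * norm A)"
    proof -
      have "dist (real_moebius A (Fin \<i>)) (boundary_point v) < e
          \<longleftrightarrow> norm (adj2 A *v v) < e * (norm v / 2) * norm A" if "A \<in> N" for A e
      proof -
        have "dist (real_moebius A (Fin \<i>)) (boundary_point v)
            = 2 * norm (adj2 A *v v) / (norm A * norm v)"
          using dist_boundary_point that N v by blast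
        then show ?thesis using pos[OF that] by (simp add: pos_divide_less_eq algebra_simps)
      qed
      then show ?thesis by simp
    qed
    also have "\<dots> \<longleftrightarrow> approaches N v"
    proof
      assume *: "\<forall>e>0. \<exists>A\<in>N. norm (adj2 A *v v) < e * (norm v / 2) * norm A"
      show "approaches N v" unfolding approaches_def
      proof (intro allI impI)
        show "\<exists>A\<in>N. norm (adj2 A *v v) < e * norm A" if "e > 0" for e
          using *[rule_format, of "e / (norm v / 2)"] that v by simp
      qed
    next
      assume "approaches N v"
      then show "\<forall>e>0. \<exists>A\<in>N. norm (adj2 A *v v) < e * (norm v / 2) * norm A"
        unfolding approaches_def using v by (intro allI impI) (meson half_gt_zero mult_pos_pos zero_less_norm_iff)
    qed
    finally show ?thesis .
  qed
  then show ?thesis unfolding forward_limit_set_def ideal_boundary_eq by auto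
qed

lemma inv_real_moebius:
  assumes "A \<in> SL2"
  shows "inv\<^bsub>moebius_group\<^esub> (real_moebius A) = real_moebius (adj2 A)"
proof -
  interpret group moebius_group by (rule group_moebius_group)
  have "det A = 1" "det (adj2 A) = 1" using assms by (simp_all add: SL2_def)
  then have "real_moebius (adj2 A) \<circ> real_moebius A = id"
    using adj2_left[OF assms] by (simp add: real_moebius_mat_1 flip: real_moebius_mult)
  then show ?thesis
    using assms adj2_SL2[of A] by (intro inv_equality)
      (auto simp: carrier_moebius_group_eq, simp add: moebius_group_def)
qed

section \<open>Lifting the semigroup to matrices\<close>

lemma semidiscrete_imp_gap:
  assumes S: "semidiscrete S"
  obtains d where "d > 0"
    "\<And>A. A \<in> SL2 \<Longrightarrow> real_moebius A \<in> S \<Longrightarrow> dist A (mat 1) < d \<Longrightarrow> real_moebius A = id"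
proof -
  have id: "mat 1 \<in> SL2" "id = real_moebius (mat 1)"
    by (simp_all add: SL2_def real_moebius_mat_1)
  then have "id \<in> topspace moebius_topology"
    unfolding topspace_moebius_topology carrier_moebius_group_eq by blast
  with S obtain U where U: "id \<in> U" "openin moebius_topology U" "\<And>y. y \<in> S \<Longrightarrow> y \<in> U \<Longrightarrow> y = id"
    unfolding semidiscrete_def in_derived_set_of by blast
  \<comment> \<open>By the quotient topology the preimage of a neighbourhood of the identity is
    open, so it contains a ball about \<open>mat 1\<close>.\<close>
  then have "openin (top_of_set SL2) {A \<in> SL2. real_moebius A \<in> U}"
    by (simp add: openin_moebius_topology)
  then obtain d where "d > 0" "\<And>A. A \<in> SL2 \<Longrightarrow> dist A (mat 1) < d \<Longrightarrow> A \<in> {A \<in> SL2. real_moebius A \<in> U}"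
    using id U(1) unfolding openin_euclidean_subtopology_iff by (smt (verit) mem_Collect_eq)
  then show thesis using that U(3) by blast
qed

text \<open>One lift is chosen for each generator. The products of the lifts map onto
  \<open>S\<close>, though they need not include both lifts of each element.\<close>

lemma finitely_generated_imp_mat_products:
  assumes S: "moebius_semigroup S" and fg: "finitely_generated S"
  obtains G where "finite G" "G \<subseteq> SL2" "S = real_moebius ` mat_products G"
proof -
  obtain F where F: "finite F" "F \<subseteq> S" "S \<subseteq> compositions F"
    using fg unfolding finitely_generated_def by blast
  then have "\<forall>f\<in>F. \<exists>A. A \<in> SL2 \<and> real_moebius A = f"
    using S by (auto simp: moebius_semigroup_def carrier_moebius_group_eq)
  then obtain l where l: "\<And>f. f \<in> F \<Longrightarrow> l f \<in> SL2 \<and> real_moebius (l f) = f" by metis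
  define G where "G = l ` F"
  have G: "G \<subseteq> SL2" using l by (auto simp: G_def)
  have comp_eq: "real_moebius (A ** B) = real_moebius A \<circ> real_moebius B"
    if "A \<in> mat_products G" "B \<in> mat_products G" for A B
    using that mat_products_SL2[OF G] by (intro real_moebius_mult) (auto simp: SL2_def)
  have "g \<in> real_moebius ` mat_products G" if "g \<in> compositions F" for g
    using that
  proof induction
    case (base f)
    then show ?case using l by (intro image_eqI[of _ _ "l f"]) (auto simp: G_def intro: mat_products.base)
  next
    case (comp f g)
    then obtain A B where "f = real_moebius A" "g = real_moebius B"
      "A \<in> mat_products G" "B \<in> mat_products G" by blast
    then show ?case using comp_eq mat_products.mult by (intro image_eqI[of _ _ "A ** B"]) auto
  qed
  moreover have "real_moebius A \<in> S" if "A \<in> mat_products G" for A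
    using that
  proof induction
    case (base A)
    then show ?case using l F(2) by (auto simp: G_def)
  next
    case (mult A B)
    then have "real_moebius A \<circ> real_moebius B \<in> S"
      using S unfolding moebius_semigroup_def by blast
    then show ?case unfolding comp_eq[OF mult.hyps] .
  qed
  ultimately have "S = real_moebius ` mat_products G" using F(3) by blast
  then show thesis using that[OF _ G] F(1) unfolding G_def by blast
qed

theorem theorem15p2:
  fixes S :: "(csphere \<Rightarrow> csphere) set"
  assumes "moebius_semigroup S"
    and "finitely_generated S"
    and "semidiscrete S"
    and "card (backward_limit_set S) \<noteq> 1"
    and "backward_limit_set S \<subseteq> forward_limit_set S"
  shows "group (moebius_group\<lparr>carrier := S\<rparr>)"
proof -
  interpret group moebius_group by (rule group_moebius_group)
  obtain G where G: "finite G" "G \<subseteq> SL2" and S_eq: "S = real_moebius ` mat_products G"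
    using finitely_generated_imp_mat_products assms(1,2) by blast
  define M where "M = mat_products G"
  interpret matrix_semigroup M
    using mat_products_SL2[OF G(2)] by unfold_locales (auto simp: M_def intro: mat_products.mult)
  have S: "S = real_moebius ` M" by (simp add: S_eq M_def)
  have comp: "real_moebius (A ** B) = real_moebius A \<circ> real_moebius B" if "A \<in> M" "B \<in> M" for A B
    using that SL2 by (intro real_moebius_mult) (auto simp: SL2_def)
  have fwd: "forward_limit_set S = boundary_point ` {v. v \<noteq> 0 \<and> approaches M v}"
    using forward_limit_set_eq[OF SL2] by (simp add: S)
  have "(\<lambda>g. inv\<^bsub>moebius_group\<^esub> g) ` S = real_moebius ` (adj2 ` M)"
    unfolding S image_image using in_SL2 by (intro image_cong refl inv_real_moebius)
  moreover have "adj2 ` M \<subseteq> SL2" using SL2 by (auto simp: adj2_SL2)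
  ultimately have bwd: "backward_limit_set S
      = boundary_point ` {v. v \<noteq> 0 \<and> approaches (adj2 ` M) v}"
    unfolding backward_limit_set_def using forward_limit_set_eq by simp
  have "inv\<^bsub>moebius_group\<^esub> g \<in> S" if g: "g \<in> S" for g
  proof (rule ccontr)
    assume ninv: "inv\<^bsub>moebius_group\<^esub> g \<notin> S"
    obtain t where t: "t \<in> M" "g = real_moebius t" using g S by blast
    obtain d where d: "d > 0"
      "\<And>A. A \<in> SL2 \<Longrightarrow> real_moebius A \<in> S \<Longrightarrow> dist A (mat 1) < d \<Longrightarrow> real_moebius A = id"
      using semidiscrete_imp_gap[OF assms(3)] by blast
    \<comment> \<open>If s t came closer than \<open>d\<close> to the identity matrix, it would act
      as the identity, and \<open>s\<close> would represent the missing inverse.\<close>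
    interpret noninvertible_matrix_semigroup M t d
    proof
      fix s assume s: "s \<in> M"
      show "d \<le> dist (s ** t) (mat 1)"
      proof (rule ccontr)
        assume "\<not> d \<le> dist (s ** t) (mat 1)"
        then have "real_moebius (s ** t) = id"
          using d(2) mult_closed[OF s t(1)] in_SL2 S by auto
        then have "real_moebius s \<circ> g = id" using comp[OF s t(1)] t(2) by simp
        then have "inv\<^bsub>moebius_group\<^esub> g = real_moebius s"
          using s t in_SL2 by (intro inv_equality)
            (auto simp: carrier_moebius_group_eq, simp add: moebius_group_def)
        then show False using ninv S s by blast
      qed
    qed (use t d in auto)
    show False
    proof (rule no_inclusion_of_limit_sets[OF G(1) M_def])
      fix v assume v: "approaches (adj2 ` M) v"
      show "approaches M v"
      proof (cases "v = 0")
        \<comment> \<open>The zero vector is no boundary point, but it satisfies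
          \<open>approaches\<close> because elements of \<open>M\<close> have positive norm.\<close>
        case True
        obtain A where "A \<in> M" using t(1) by blast
        then show ?thesis
          unfolding approaches_def True using norm_SL2_pos in_SL2 by auto
      next
        case False
        then have "boundary_point v \<in> forward_limit_set S" using assms(5) v bwd by blast
        then obtain w where w: "w \<noteq> 0" "approaches M w" "boundary_point v = boundary_point w"
          unfolding fwd by blast
        then have "cross2 w v = 0" using False boundary_point_eq_iff by metis
        then obtain k where "v = k *\<^sub>R w" using cross2_eq_0_imp_scaleR w(1) by blast
        then show ?thesis using approaches_scaleR w(2) by blast
      qed
    next
      fix v :: "real^2" assume v: "v \<noteq> 0" "approaches (adj2 ` M) v"
      show "\<exists>y. approaches (adj2 ` M) y \<and> cross2 v y \<noteq> 0"
      \<comment> \<open>If all backward limit directions were parallel to \<open>v\<close>, the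
        backward limit set would be a singleton, against the cardinality hypothesis.\<close>
      proof (rule ccontr)
        assume "\<not> ?thesis"
        then have "boundary_point y = boundary_point v" if "y \<noteq> 0" "approaches (adj2 ` M) y" for y
          using that v(1) boundary_point_eq_iff by metis
        then have "backward_limit_set S = {boundary_point v}"
          unfolding bwd using v by blast
        then show False using assms(4) by simp
      qed
    qed
  qed
  then have "subgroup S moebius_group"
    using assms(1) by (intro subgroupI) (auto simp: moebius_semigroup_def, simp add: moebius_group_def)
  then show ?thesis by (rule subgroup_imp_group)
qed
end
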